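(* Let $s\geqslant1$ and consider Kripke's schema (KS): $\exists G^m[\varphi\equiv\exists x(G(x)(0)^{m-1}\neq0)]$, where $\varphi$ is a formula of $L$, $G^m$ is not free in $\varphi$, and $m\geqslant\max(sort(\varphi),1)$. Then: (1) $LP_s+(C_s)\vdash(KS_s)$; (2) $LP+(C)\vdash(KS)$; (3) $\mathcal{B}_s\Vdash(KS_s)$ (the universal closure of every instance with types $\leqslant s$ is forced at the root).
   Context: For an $m$-functional $G$, $G(x)(0)^{m-1}$ is $G(x)(0)\cdots(0)$ with $m-1$ applications to $0$ (a number term). $sort(\varphi)$ = maximal type of free variables (0 if none). For an axiom schema $(A)$, $(A_s)$ is its version with all types $\leqslant s$. Languages: $L_s$ has variables $x,y,\dots$ (type 0), and for $1\leqslant n\leqslant s$: $F^n$ ($n$-functionals), $A^n$ (lawlike), $\mathcal F^n$ (lawless), of type $n$; constants $0,K^n$; function symbols $S,+,\cdot,N^n,Ap^n$ ($Z(t)=Ap(Z,t)$ lowers type by 1, a 1-functional applied to a term gives a term); atomic formulas $t=_0\tau$, $Z=_nV$; intuitionistic connectives and quantifiers. $L=\bigcup_sL_s$. $LP_s$ ($LP$) adds atomic formulas $\vdash_z\varphi(\bar X)$ for terms $z$ and formulas $\varphi$ of $L_s$ ($L$) with free variables in $\bar X$. Theory $LP$ (and its fragment $LP_s$ with types $\leqslant s$): intuitionistic logic with equality; axioms $Sx\neq0$, $Sx=Sy\supset x=y$, $x+0=x$, $x+Sy=S(x+y)$, $x\cdot0=0$, $x\cdot Sy=x\cdot y+x$;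 induction for all formulas; $K^{n+1}(x)=K^n$ ($K^0:=0$); $\neg(N^n(F^n)=K^n)$; $N^{n+1}(F)(x)=N^n(F(x))$; $N^n(F)=N^n(G)\supset F=G$; $\exists A^1\forall x(A(x)=t)$ for terms $t$ with only number and lawlike-1-functional variables; for $\varphi$ in $L$: (CS1) $(\vdash_z\varphi)\vee\neg(\vdash_z\varphi)$, (CS2) $(\vdash_z\varphi)\supset(\vdash_{z+y}\varphi)$, (CS3) $\exists z(\vdash_z\varphi)\equiv\varphi$. (C) is the conjunction of the closures of (C1) $\forall x\exists y\,\varphi(x,y)\supset\exists F^m\forall x\,\varphi(x,F(x)(0)^{m-1})$ for $\varphi$ in $LP$, $m\geqslant\max(sort(\varphi),1)$, and (C2) $\forall x\exists!G^n\varphi(x,G)\supset\exists F^m\forall x\,\varphi(x,F(x)(0)^{m-n-1})$ for $\varphi$ in $LP$, $m\geqslant\max(sort(\varphi),n+1)$. Beth model $\mathcal{B}_s$: path = maximal chain. $a_0=\omega$, $d_0=\{\langle x\rangle:x\in\omega^*\}$ ordered by extension ($\langle x\rangle\preccurlyeq_0\langle y\rangle$ iff $y$ is an initial segment of $x$). For $k\geqslant1$: $a_k$ = partial $f:d_{k-1}\times\omega\dashrightarrow a_{k-1}$, monotonic ($y\preccurlyeq_{k-1}x\Rightarrow f(x,\cdot)\subseteq f(y,\cdot)$) and complete (along every path of $d_{k-1}$ the union of $f(x,\cdot)$ is total); $d_k$ = tuples $\langle x_0,\dots,x_k\rangle$ of sequences of a common length $m=lh$ with $x_i\in a_i^{(m)}$,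 ordered componentwise by extension. Nodes $M=d_{s-1}$, root $\varepsilon$, $\bar\alpha(k)=\langle\alpha_0,\dots,\alpha_{k-1}\rangle$. Domains $\omega$, $a_k$, $b_k=\{f\in a_k:f(\text{root},\cdot)\text{ total}\}$, $l_k=\{\nu_k(\xi)\}$ where $\xi:\omega\times a_{k-1}\to a_{k-1}$ has all $\xi(n,\cdot)$ bijective and $\nu_k(\xi)(x,n)=\xi(n,\langle\langle x\rangle_{k-1}\rangle_n)$ for $n<lh(x)$, undefined otherwise. $\widehat K^1(x,n)=0$, $\widehat K^{k+1}(x,n)=\widehat K^k$; $N^k\mapsto S^k$ ($S^0(x)=x+1$, $S^{n+1}(f)=S^n\circ f$); at node $\alpha$, $Ap^k(f,n)=f(\bar\alpha(k),n)$. $Val(\alpha,Z=V)=T$ iff both values at $\alpha$ defined and equal; $Val(\alpha,\vdash_t\varphi)=T$ iff $t^{[\alpha]}$ defined and some $\gamma\succcurlyeq\alpha$ with $lh(\gamma)=t^{[\alpha]}$ forces $\varphi$. Beth forcing: atomic, $\vee$, $\exists$ require every path through $\alpha$ to meet a node where the atomic valuation holds / a disjunct / an instance is forced; $\supset$ quantifies over all later nodes; $\wedge,\forall$ pointwise; $\bot$ never forced; $\mathcal B_s\Vdash\varphi$ iff $\varepsilon\Vdash\varphi$. *)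

theory Defs
  imports Main "HOL-Library.Sublist"
begin

text \<open>Variable kinds: KF = n-functional variables F^n, KA = lawlike A^n,
  KL = lawless (script F)^n.\<close>
datatype kind = KF | KA | KL

text \<open>NV i : number variable (type 0);  HV k n i : i-th variable of kind k and type n (n >= 1).\<close>
datatype var = NV nat | HV kind nat nat

fun vty :: "var \<Rightarrow> nat" where
  "vty (NV _) = 0"
| "vty (HV _ n _) = n"

fun vwf :: "var \<Rightarrow> bool" where
  "vwf (NV _) = True"
| "vwf (HV _ n _) = (1 \<le> n)"

datatype trm = V var | Zr | Kc nat | Sc trm | Pl trm trm | Tm trm trm | Nc nat trm | Ap nat trm trm

fun ty :: "trm \<Rightarrow> nat option" where
  "ty (V v) = (if vwf v then Some (vty v) else None)"
| "ty Zr = Some 0"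
| "ty (Kc n) = (if 1 \<le> n then Some n else None)"
| "ty (Sc t) = (if ty t = Some 0 then Some 0 else None)"
| "ty (Pl a b) = (if ty a = Some 0 \<and> ty b = Some 0 then Some 0 else None)"
| "ty (Tm a b) = (if ty a = Some 0 \<and> ty b = Some 0 then Some 0 else None)"
| "ty (Nc n t) = (if 1 \<le> n \<and> ty t = Some n then Some n else None)"
| "ty (Ap n f t) = (if 1 \<le> n \<and> ty f = Some n \<and> ty t = Some 0 then Some (n - 1) else None)"

fun tmax :: "trm \<Rightarrow> nat" where
  "tmax (V v) = vty v"
| "tmax Zr = 0"
| "tmax (Kc n) = n"
| "tmax (Sc t) = tmax t"
| "tmax (Pl a b) = max (tmax a) (tmax b)"
| "tmax (Tm a b) = max (tmax a) (tmax b)"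
| "tmax (Nc n t) = max n (tmax t)"
| "tmax (Ap n f t) = max n (max (tmax f) (tmax t))"

fun fvt :: "trm \<Rightarrow> var set" where
  "fvt (V v) = {v}"
| "fvt Zr = {}"
| "fvt (Kc n) = {}"
| "fvt (Sc t) = fvt t"
| "fvt (Pl a b) = fvt a \<union> fvt b"
| "fvt (Tm a b) = fvt a \<union> fvt b"
| "fvt (Nc n t) = fvt t"
| "fvt (Ap n f t) = fvt f \<union> fvt t"

fun substt :: "var \<Rightarrow> trm \<Rightarrow> trm \<Rightarrow> trm" where
  "substt x s (V v) = (if v = x then s else V v)"
| "substt x s Zr = Zr"
| "substt x s (Kc n) = Kc n"
| "substt x s (Sc t) = Sc (substt x s t)"
| "substt x s (Pl a b) = Pl (substt x s a) (substt x s b)"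
| "substt x s (Tm a b) = Tm (substt x s a) (substt x s b)"
| "substt x s (Nc n t) = Nc n (substt x s t)"
| "substt x s (Ap n f t) = Ap n (substt x s f) (substt x s t)"

text \<open>K^0 := 0 and N^0 := S (cf. the model: S^0(x) = x+1).\<close>
definition kk :: "nat \<Rightarrow> trm" where "kk n = (if n = 0 then Zr else Kc n)"
definition nn :: "nat \<Rightarrow> trm \<Rightarrow> trm" where "nn n t = (if n = 0 then Sc t else Nc n t)"

text \<open>Formulas.  Prf z phi is the atomic formula  |-_z phi.\<close>
datatype frm = Bot | Eq0 trm trm | EqH nat trm trm | Prf trm frm
  | Cj frm frm | Dj frm frm | Im frm frm | Al var frm | Exi var frm

definition Neg :: "frm \<Rightarrow> frm" where "Neg a = Im a Bot"
definition Iff :: "frm \<Rightarrow> frm \<Rightarrow> frm" where "Iff a b = Cj (Im a b) (Im b a)"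
definition eqty :: "nat \<Rightarrow> trm \<Rightarrow> trm \<Rightarrow> frm" where
  "eqty n a b = (if n = 0 then Eq0 a b else EqH n a b)"

fun isL :: "frm \<Rightarrow> bool" where
  "isL Bot = True"
| "isL (Eq0 a b) = True"
| "isL (EqH n a b) = True"
| "isL (Prf z a) = False"
| "isL (Cj a b) = (isL a \<and> isL b)"
| "isL (Dj a b) = (isL a \<and> isL b)"
| "isL (Im a b) = (isL a \<and> isL b)"
| "isL (Al x a) = isL a"
| "isL (Exi x a) = isL a"

fun wf :: "frm \<Rightarrow> bool" where
  "wf Bot = True"
| "wf (Eq0 a b) = (ty a = Some 0 \<and> ty b = Some 0)"
| "wf (EqH n a b) = (1 \<le> n \<and> ty a = Some n \<and> ty b = Some n)"
| "wf (Prf z a) = (ty z = Some 0 \<and> wf a \<and> isL a)"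
| "wf (Cj a b) = (wf a \<and> wf b)"
| "wf (Dj a b) = (wf a \<and> wf b)"
| "wf (Im a b) = (wf a \<and> wf b)"
| "wf (Al x a) = (vwf x \<and> wf a)"
| "wf (Exi x a) = (vwf x \<and> wf a)"

fun fmax :: "frm \<Rightarrow> nat" where
  "fmax Bot = 0"
| "fmax (Eq0 a b) = max (tmax a) (tmax b)"
| "fmax (EqH n a b) = max n (max (tmax a) (tmax b))"
| "fmax (Prf z a) = max (tmax z) (fmax a)"
| "fmax (Cj a b) = max (fmax a) (fmax b)"
| "fmax (Dj a b) = max (fmax a) (fmax b)"
| "fmax (Im a b) = max (fmax a) (fmax b)"
| "fmax (Al x a) = max (vty x) (fmax a)"
| "fmax (Exi x a) = max (vty x) (fmax a)"

text \<open>Formula of LP_s (b = Some s) resp. of LP (b = None).\<close>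
definition inLang :: "nat option \<Rightarrow> frm \<Rightarrow> bool" where
  "inLang b a = (wf a \<and> (case b of None \<Rightarrow> True | Some s \<Rightarrow> fmax a \<le> s))"

fun fvf :: "frm \<Rightarrow> var set" where
  "fvf Bot = {}"
| "fvf (Eq0 a b) = fvt a \<union> fvt b"
| "fvf (EqH n a b) = fvt a \<union> fvt b"
| "fvf (Prf z a) = fvt z \<union> fvf a"
| "fvf (Cj a b) = fvf a \<union> fvf b"
| "fvf (Dj a b) = fvf a \<union> fvf b"
| "fvf (Im a b) = fvf a \<union> fvf b"
| "fvf (Al x a) = fvf a - {x}"
| "fvf (Exi x a) = fvf a - {x}"

definition sortf :: "frm \<Rightarrow> nat" where
  "sortf a = Max (insert 0 (vty ` fvf a))"

fun subst :: "var \<Rightarrow> trm \<Rightarrow> frm \<Rightarrow> frm" where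
  "subst x s Bot = Bot"
| "subst x s (Eq0 a b) = Eq0 (substt x s a) (substt x s b)"
| "subst x s (EqH n a b) = EqH n (substt x s a) (substt x s b)"
| "subst x s (Prf z a) = Prf (substt x s z) (subst x s a)"
| "subst x s (Cj a b) = Cj (subst x s a) (subst x s b)"
| "subst x s (Dj a b) = Dj (subst x s a) (subst x s b)"
| "subst x s (Im a b) = Im (subst x s a) (subst x s b)"
| "subst x s (Al y a) = (if y = x then Al y a else Al y (subst x s a))"
| "subst x s (Exi y a) = (if y = x then Exi y a else Exi y (subst x s a))"

fun freefor :: "var \<Rightarrow> trm \<Rightarrow> frm \<Rightarrow> bool" where
  "freefor x s Bot = True"
| "freefor x s (Eq0 a b) = True"
| "freefor x s (EqH n a b) = True"
| "freefor x s (Prf z a) = freefor x s a"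
| "freefor x s (Cj a b) = (freefor x s a \<and> freefor x s b)"
| "freefor x s (Dj a b) = (freefor x s a \<and> freefor x s b)"
| "freefor x s (Im a b) = (freefor x s a \<and> freefor x s b)"
| "freefor x s (Al y a) = (x \<notin> fvf (Al y a) \<or> (y \<notin> fvt s \<and> freefor x s a))"
| "freefor x s (Exi y a) = (x \<notin> fvf (Exi y a) \<or> (y \<notin> fvt s \<and> freefor x s a))"

fun inst_ok :: "var \<Rightarrow> trm \<Rightarrow> bool" where
  "inst_ok (NV i) t = (ty t = Some 0)"
| "inst_ok (HV KF n i) t = (ty t = Some n)"
| "inst_ok (HV KA n i) t = (1 \<le> n \<and> (\<exists>j. t = V (HV KA n j)))"
| "inst_ok (HV KL n i) t = (1 \<le> n \<and> (\<exists>j. t = V (HV KL n j)))"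

fun iterap :: "nat \<Rightarrow> nat \<Rightarrow> trm \<Rightarrow> trm" where
  "iterap 0 k t = t"
| "iterap (Suc j) k t = iterap j (k - 1) (Ap k t Zr)"

definition appz :: "var \<Rightarrow> var \<Rightarrow> nat \<Rightarrow> nat \<Rightarrow> trm" where
  "appz F x m j = iterap j (m - 1) (Ap m (V F) (V x))"

inductive lpax :: "frm \<Rightarrow> bool" where
  k1: "lpax (Im a (Im b a))"
| k2: "lpax (Im (Im a (Im b c)) (Im (Im a b) (Im a c)))"
| c1: "lpax (Im (Cj a b) a)"
| c2: "lpax (Im (Cj a b) b)"
| c3: "lpax (Im a (Im b (Cj a b)))"
| d1: "lpax (Im a (Dj a b))"
| d2: "lpax (Im b (Dj a b))"
| d3: "lpax (Im (Im a c) (Im (Im b c) (Im (Dj a b) c)))"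
| efq: "lpax (Im Bot a)"
| alle: "inst_ok x t \<Longrightarrow> freefor x t a \<Longrightarrow> lpax (Im (Al x a) (subst x t a))"
| exi: "inst_ok x t \<Longrightarrow> freefor x t a \<Longrightarrow> lpax (Im (subst x t a) (Exi x a))"
| refl: "lpax (eqty (vty x) (V x) (V x))"
| leib: "vty x = vty z \<Longrightarrow> vty y = vty z \<Longrightarrow> freefor z (V x) a \<Longrightarrow> freefor z (V y) a \<Longrightarrow>
     lpax (Im (eqty (vty z) (V x) (V y)) (Im (subst z (V x) a) (subst z (V y) a)))"
| s1: "lpax (Neg (Eq0 (Sc (V (NV i))) Zr))"
| s2: "lpax (Im (Eq0 (Sc (V (NV i))) (Sc (V (NV j)))) (Eq0 (V (NV i)) (V (NV j))))"
| p1: "lpax (Eq0 (Pl (V (NV i)) Zr) (V (NV i)))"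
| p2: "lpax (Eq0 (Pl (V (NV i)) (Sc (V (NV j)))) (Sc (Pl (V (NV i)) (V (NV j)))))"
| t1: "lpax (Eq0 (Tm (V (NV i)) Zr) Zr)"
| t2: "lpax (Eq0 (Tm (V (NV i)) (Sc (V (NV j)))) (Pl (Tm (V (NV i)) (V (NV j))) (V (NV i))))"
| ind: "lpax (Im (Cj (subst (NV i) Zr a) (Al (NV i) (Im a (subst (NV i) (Sc (V (NV i))) a))))
             (Al (NV i) a))"
| kax: "lpax (eqty n (Ap (Suc n) (Kc (Suc n)) (V (NV i))) (kk n))"
| nk: "1 \<le> n \<Longrightarrow> lpax (Neg (EqH n (Nc n (V (HV KF n j))) (Kc n)))"
| nap: "lpax (eqty n (Ap (Suc n) (Nc (Suc n) (V (HV KF (Suc n) j))) (V (NV i)))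
                    (nn n (Ap (Suc n) (V (HV KF (Suc n) j)) (V (NV i)))))"
| ninj: "1 \<le> n \<Longrightarrow> lpax (Im (EqH n (Nc n (V (HV KF n j))) (Nc n (V (HV KF n k))))
                          (EqH n (V (HV KF n j)) (V (HV KF n k))))"
| comp: "ty t = Some 0 \<Longrightarrow> (\<forall>v\<in>fvt t. (\<exists>l. v = NV l) \<or> (\<exists>l. v = HV KA 1 l)) \<Longrightarrow>
     HV KA 1 j \<notin> fvt t \<Longrightarrow>
     lpax (Exi (HV KA 1 j) (Al (NV i) (Eq0 (Ap 1 (V (HV KA 1 j)) (V (NV i))) t)))"
| cs1: "isL a \<Longrightarrow> lpax (Dj (Prf (V (NV i)) a) (Neg (Prf (V (NV i)) a)))"
| cs2: "isL a \<Longrightarrow> lpax (Im (Prf (V (NV i)) a) (Prf (Pl (V (NV i)) (V (NV j))) a))"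
| cs3: "isL a \<Longrightarrow> NV i \<notin> fvf a \<Longrightarrow> lpax (Iff (Exi (NV i) (Prf (V (NV i)) a)) a)"

inductive deriv :: "nat option \<Rightarrow> frm set \<Rightarrow> frm \<Rightarrow> bool" for b E where
  ax: "lpax a \<Longrightarrow> inLang b a \<Longrightarrow> deriv b E a"
| hyp: "a \<in> E \<Longrightarrow> inLang b a \<Longrightarrow> deriv b E a"
| mp: "deriv b E a \<Longrightarrow> deriv b E (Im a c) \<Longrightarrow> deriv b E c"
| gen: "deriv b E (Im c a) \<Longrightarrow> x \<notin> fvf c \<Longrightarrow> inLang b (Im c (Al x a)) \<Longrightarrow>
        deriv b E (Im c (Al x a))"
| exel: "deriv b E (Im a c) \<Longrightarrow> x \<notin> fvf c \<Longrightarrow> inLang b (Im (Exi x a) c) \<Longrightarrow>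
        deriv b E (Im (Exi x a) c)"

inductive cax :: "frm \<Rightarrow> bool" where
  C1: "x = NV i \<Longrightarrow> y = NV j \<Longrightarrow> i \<noteq> j \<Longrightarrow> F = HV KF m k \<Longrightarrow> F \<notin> fvf a \<Longrightarrow>
       m \<ge> max (sortf a) 1 \<Longrightarrow> freefor y (appz F x m (m - 1)) a \<Longrightarrow>
       cax (Im (Al x (Exi y a)) (Exi F (Al x (subst y (appz F x m (m - 1)) a))))"
| C2: "x = NV i \<Longrightarrow> G = HV KF n j \<Longrightarrow> G' = HV KF n j' \<Longrightarrow> j \<noteq> j' \<Longrightarrow> 1 \<le> n \<Longrightarrow>
       G' \<notin> fvf a \<Longrightarrow> freefor G (V G') a \<Longrightarrow>
       F = HV KF m k \<Longrightarrow> F \<notin> fvf a \<Longrightarrow> F \<noteq> G \<Longrightarrow>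
       m \<ge> max (sortf a) (n + 1) \<Longrightarrow> freefor G (appz F x m (m - n - 1)) a \<Longrightarrow>
       cax (Im (Al x (Exi G (Cj a (Al G' (Im (subst G (V G') a) (EqH n (V G) (V G')))))))
               (Exi F (Al x (subst G (appz F x m (m - n - 1)) a))))"

definition Cset :: "frm set" where "Cset = {a. cax a}"

inductive ks :: "frm \<Rightarrow> bool" where
  "isL a \<Longrightarrow> G = HV KF m k \<Longrightarrow> G \<notin> fvf a \<Longrightarrow> m \<ge> max (sortf a) 1 \<Longrightarrow> x = NV i \<Longrightarrow>
   ks (Exi G (Iff a (Exi x (Neg (Eq0 (appz G x m (m - 1)) Zr)))))"

text \<open>The model is built inside an arbitrary carrier type 'u: num encodes omega = a_0,
  A k is the domain a_k, and app f x n is f(x,n) for f in a_k.  beth_univ states that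
  (num, A, app) is a faithful copy of the hierarchy a_0,...,a_s.\<close>

type_synonym 'u node = "'u list list"

definition dset :: "(nat \<Rightarrow> 'u set) \<Rightarrow> nat \<Rightarrow> 'u node set" where
  "dset A k = {xs. length xs = Suc k \<and> (\<exists>m. \<forall>i<Suc k. length (xs ! i) = m \<and> set (xs ! i) \<subseteq> A i)}"

text \<open>ext a b: a is later than (componentwise extends) b, i.e. a \<preccurlyeq> b.\<close>
definition ext :: "'u node \<Rightarrow> 'u node \<Rightarrow> bool" where
  "ext a b = (length a = length b \<and> (\<forall>i<length a. prefix (b ! i) (a ! i)))"

definition lh :: "'u node \<Rightarrow> nat" where "lh a = length (a ! 0)"

definition paths :: "'u node set \<Rightarrow> 'u node set set" where
  "paths D = {P. P \<subseteq> D \<and> (\<forall>x\<in>P. \<forall>y\<in>P. ext x y \<or> ext y x) \<and>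
                 (\<forall>z\<in>D. (\<forall>x\<in>P. ext z x \<or> ext x z) \<longrightarrow> z \<in> P)}"

definition validfn :: "(nat \<Rightarrow> 'u set) \<Rightarrow> nat \<Rightarrow> ('u node \<Rightarrow> nat \<Rightarrow> 'u option) \<Rightarrow> bool" where
  "validfn A k g =
    ((\<forall>x n. x \<notin> dset A (k - 1) \<longrightarrow> g x n = None) \<and>
     (\<forall>x n v. g x n = Some v \<longrightarrow> v \<in> A (k - 1)) \<and>
     (\<forall>x\<in>dset A (k - 1). \<forall>y\<in>dset A (k - 1). ext y x \<longrightarrow>
        (\<forall>n v. g x n = Some v \<longrightarrow> g y n = Some v)) \<and>
     (\<forall>P\<in>paths (dset A (k - 1)). \<forall>n. \<exists>x\<in>P. g x n \<noteq> None))"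

definition beth_univ :: "nat \<Rightarrow> (nat \<Rightarrow> 'u) \<Rightarrow> (nat \<Rightarrow> 'u set) \<Rightarrow> ('u \<Rightarrow> 'u node \<Rightarrow> nat \<Rightarrow> 'u option) \<Rightarrow> bool" where
  "beth_univ s num A app =
    (inj num \<and> A 0 = range num \<and>
     (\<forall>k. 1 \<le> k \<and> k \<le> s \<longrightarrow> bij_betw app (A k) {g. validfn A k g}))"

definition bset :: "(nat \<Rightarrow> 'u set) \<Rightarrow> ('u \<Rightarrow> 'u node \<Rightarrow> nat \<Rightarrow> 'u option) \<Rightarrow> nat \<Rightarrow> 'u set" where
  "bset A app k = {f \<in> A k. \<forall>n. app f (replicate k []) n \<noteq> None}"

definition lset :: "(nat \<Rightarrow> 'u set) \<Rightarrow> ('u \<Rightarrow> 'u node \<Rightarrow> nat \<Rightarrow> 'u option) \<Rightarrow> nat \<Rightarrow> 'u set" where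
  "lset A app k = {f \<in> A k. \<exists>\<xi>. (\<forall>n. bij_betw (\<xi> n) (A (k - 1)) (A (k - 1))) \<and>
      (\<forall>x n. app f x n = (if x \<in> dset A (k - 1) \<and> n < lh x
                           then Some (\<xi> n (x ! (k - 1) ! n)) else None))}"

fun vdom :: "(nat \<Rightarrow> 'u set) \<Rightarrow> ('u \<Rightarrow> 'u node \<Rightarrow> nat \<Rightarrow> 'u option) \<Rightarrow> var \<Rightarrow> 'u set" where
  "vdom A app (NV i) = A 0"
| "vdom A app (HV KF n i) = A n"
| "vdom A app (HV KA n i) = bset A app n"
| "vdom A app (HV KL n i) = lset A app n"

fun Khat :: "(nat \<Rightarrow> 'u) \<Rightarrow> (nat \<Rightarrow> 'u set) \<Rightarrow> ('u \<Rightarrow> 'u node \<Rightarrow> nat \<Rightarrow> 'u option) \<Rightarrow> nat \<Rightarrow> 'u" where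
  "Khat num A app 0 = num 0"
| "Khat num A app (Suc k) = (THE f. f \<in> A (Suc k) \<and>
     (\<forall>x n. app f x n = (if x \<in> dset A k then Some (Khat num A app k) else None)))"

fun Shat :: "(nat \<Rightarrow> 'u) \<Rightarrow> (nat \<Rightarrow> 'u set) \<Rightarrow> ('u \<Rightarrow> 'u node \<Rightarrow> nat \<Rightarrow> 'u option) \<Rightarrow> nat \<Rightarrow> 'u \<Rightarrow> 'u" where
  "Shat num A app 0 u = num (Suc (inv num u))"
| "Shat num A app (Suc k) f = (THE g. g \<in> A (Suc k) \<and>
     (\<forall>x n. app g x n = map_option (Shat num A app k) (app f x n)))"

fun evalt :: "(nat \<Rightarrow> 'u) \<Rightarrow> (nat \<Rightarrow> 'u set) \<Rightarrow> ('u \<Rightarrow> 'u node \<Rightarrow> nat \<Rightarrow> 'u option) \<Rightarrow>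
              (var \<Rightarrow> 'u) \<Rightarrow> 'u node \<Rightarrow> trm \<Rightarrow> 'u option" where
  "evalt num A app e a (V v) = Some (e v)"
| "evalt num A app e a Zr = Some (num 0)"
| "evalt num A app e a (Kc n) = Some (Khat num A app n)"
| "evalt num A app e a (Sc t) = map_option (\<lambda>u. num (Suc (inv num u))) (evalt num A app e a t)"
| "evalt num A app e a (Pl t r) = (case (evalt num A app e a t, evalt num A app e a r) of
      (Some u, Some w) \<Rightarrow> Some (num (inv num u + inv num w)) | _ \<Rightarrow> None)"
| "evalt num A app e a (Tm t r) = (case (evalt num A app e a t, evalt num A app e a r) of
      (Some u, Some w) \<Rightarrow> Some (num (inv num u * inv num w)) | _ \<Rightarrow> None)"
| "evalt num A app e a (Nc n t) = map_option (Shat num A app n) (evalt num A app e a t)"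
| "evalt num A app e a (Ap n f t) = (case (evalt num A app e a f, evalt num A app e a t) of
      (Some u, Some w) \<Rightarrow> app u (take n a) (inv num w) | _ \<Rightarrow> None)"

definition barred :: "nat \<Rightarrow> (nat \<Rightarrow> 'u set) \<Rightarrow> 'u node \<Rightarrow> ('u node \<Rightarrow> bool) \<Rightarrow> bool" where
  "barred s A a Q = (\<forall>P\<in>paths (dset A (s - 1)). a \<in> P \<longrightarrow> (\<exists>b\<in>P. ext b a \<and> Q b))"

primrec forces :: "nat \<Rightarrow> (nat \<Rightarrow> 'u) \<Rightarrow> (nat \<Rightarrow> 'u set) \<Rightarrow> ('u \<Rightarrow> 'u node \<Rightarrow> nat \<Rightarrow> 'u option) \<Rightarrow>
                   frm \<Rightarrow> 'u node \<Rightarrow> (var \<Rightarrow> 'u) \<Rightarrow> bool" where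
  "forces s num A app Bot a e = False"
| "forces s num A app (Eq0 t r) a e = barred s A a (\<lambda>b.
      evalt num A app e b t \<noteq> None \<and> evalt num A app e b t = evalt num A app e b r)"
| "forces s num A app (EqH n t r) a e = barred s A a (\<lambda>b.
      evalt num A app e b t \<noteq> None \<and> evalt num A app e b t = evalt num A app e b r)"
| "forces s num A app (Prf z p) a e = barred s A a (\<lambda>b.
      \<exists>u. evalt num A app e b z = Some u \<and>
          (\<exists>c\<in>dset A (s - 1). ext b c \<and> lh c = inv num u \<and> forces s num A app p c e))"
| "forces s num A app (Cj p q) a e = (forces s num A app p a e \<and> forces s num A app q a e)"
| "forces s num A app (Dj p q) a e = barred s A a (\<lambda>b.
      forces s num A app p b e \<or> forces s num A app q b e)"
| "forces s num A app (Im p q) a e = (\<forall>b\<in>dset A (s - 1). ext b a \<longrightarrow>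
      forces s num A app p b e \<longrightarrow> forces s num A app q b e)"
| "forces s num A app (Al x p) a e = (\<forall>d\<in>vdom A app x. forces s num A app p a (e(x := d)))"
| "forces s num A app (Exi x p) a e = barred s A a (\<lambda>b.
      \<exists>d\<in>vdom A app x. forces s num A app p b (e(x := d)))"

definition admissible :: "nat \<Rightarrow> (nat \<Rightarrow> 'u set) \<Rightarrow> ('u \<Rightarrow> 'u node \<Rightarrow> nat \<Rightarrow> 'u option) \<Rightarrow> (var \<Rightarrow> 'u) \<Rightarrow> bool" where
  "admissible s A app e = (\<forall>v. vwf v \<and> vty v \<le> s \<longrightarrow> e v \<in> vdom A app v)"

end

theory Submission
  imports Defs
begin

text \<open>
  Derivability: by (CS1) the formula stating that \<open>y \<noteq> 0\<close> exactly when \<open>\<turnstile>\<^sub>x \<phi>\<close> has a solution \<open>y\<close> for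
  every \<open>x\<close>, so (C1) yields a functional \<open>G\<close> with \<open>\<turnstile>\<^sub>x \<phi> \<equiv> G(x)(0)\<dots>(0) \<noteq> 0\<close>, and (CS3) turns
  \<open>\<exists>x. \<turnstile>\<^sub>x \<phi>\<close> into \<open>\<phi>\<close>.

  Forcing: permuting the labels in the components \<open>\<ge> m\<close> of the nodes induces an automorphism of the
  Beth model that fixes all functionals of type \<open>\<le> m\<close>. Hence whether a node forces a formula of
  sort \<open>\<le> m\<close> depends only on the first \<open>m\<close> components of the node. So a single functional of type
  \<open>m\<close> can record, as soon as the node has length \<open>\<ge> n\<close>, whether its restriction to length \<open>n\<close>
  forces \<open>\<phi>\<close>.
\<close>

section \<open>Syntax\<close>

text \<open>Isolates the type bound, so that one derivation with a parameter \<open>b\<close> covers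
  both LP_s and LP.\<close>

definition lang_ty :: "nat option \<Rightarrow> nat \<Rightarrow> bool" where
  "lang_ty b n = (case b of None \<Rightarrow> True | Some s \<Rightarrow> n \<le> s)"

lemma lang_ty_0 [simp]: "lang_ty b 0"
  by (simp add: lang_ty_def split: option.split)

lemma lang_ty_max [simp]: "lang_ty b (max m n) \<longleftrightarrow> lang_ty b m \<and> lang_ty b n"
  by (auto simp: lang_ty_def split: option.split)

lemma inLang_alt: "inLang b a \<longleftrightarrow> wf a \<and> lang_ty b (fmax a)"
  by (simp add: inLang_def lang_ty_def)

lemma inLang_simps [simp]:
  "inLang b Bot"
  "inLang b (Eq0 t r) \<longleftrightarrow> ty t = Some 0 \<and> ty r = Some 0 \<and> lang_ty b (tmax t) \<and> lang_ty b (tmax r)"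
  "inLang b (Prf t p) \<longleftrightarrow> ty t = Some 0 \<and> isL p \<and> lang_ty b (tmax t) \<and> inLang b p"
  "inLang b (Cj p q) \<longleftrightarrow> inLang b p \<and> inLang b q"
  "inLang b (Dj p q) \<longleftrightarrow> inLang b p \<and> inLang b q"
  "inLang b (Im p q) \<longleftrightarrow> inLang b p \<and> inLang b q"
  "inLang b (Al x p) \<longleftrightarrow> vwf x \<and> lang_ty b (vty x) \<and> inLang b p"
  "inLang b (Exi x p) \<longleftrightarrow> vwf x \<and> lang_ty b (vty x) \<and> inLang b p"
  "inLang b (Neg p) \<longleftrightarrow> inLang b p"
  "inLang b (Iff p q) \<longleftrightarrow> inLang b p \<and> inLang b q"
  by (auto simp: inLang_alt Neg_def Iff_def)

lemma fvf_Neg_Iff [simp]: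
  "fvf (Neg p) = fvf p" "fvf (Iff p q) = fvf p \<union> fvf q"
  by (auto simp: Neg_def Iff_def)

lemma subst_Neg_Iff [simp]:
  "subst x t (Neg p) = Neg (subst x t p)" "subst x t (Iff p q) = Iff (subst x t p) (subst x t q)"
  by (auto simp: Neg_def Iff_def)

lemma freefor_Neg_Iff [simp]:
  "freefor x t (Neg p) = freefor x t p"
  "freefor x t (Iff p q) \<longleftrightarrow> freefor x t p \<and> freefor x t q"
  by (auto simp: Neg_def Iff_def)

lemma finite_fvt [simp]: "finite (fvt t)"
  by (induction t) auto

lemma finite_fvf [simp]: "finite (fvf a)"
  by (induction a) auto

lemma substt_fresh: "x \<notin> fvt r \<Longrightarrow> substt x t r = r"
  by (induction r) auto

lemma subst_fresh: "x \<notin> fvf a \<Longrightarrow> subst x t a = a"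
  by (induction a) (auto simp: substt_fresh)

lemma freefor_fresh: "x \<notin> fvf a \<Longrightarrow> freefor x t a"
  by (induction a) auto

lemma substt_self [simp]: "substt x (V x) r = r"
  by (induction r) auto

lemma subst_self [simp]: "subst x (V x) a = a"
  by (induction a) auto

lemma freefor_self [simp]: "freefor x (V x) a"
  by (induction a) auto

lemma fvt_iterap [simp]: "fvt (iterap j k t) = fvt t"
  by (induction j arbitrary: k t) auto

lemma substt_iterap [simp]: "substt x r (iterap j k t) = iterap j k (substt x r t)"
  by (induction j arbitrary: k t) auto

lemma ty_iterap: "ty t = Some k \<Longrightarrow> j \<le> k \<Longrightarrow> ty (iterap j k t) = Some (k - j)"
  by (induction j arbitrary: k t) auto

lemma lang_ty_mono: "lang_ty b n \<Longrightarrow> m \<le> n \<Longrightarrow> lang_ty b m"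
  by (auto simp: lang_ty_def split: option.splits)

lemma lang_ty_iterap: "lang_ty b (tmax t) \<Longrightarrow> lang_ty b k \<Longrightarrow> lang_ty b (tmax (iterap j k t))"
proof (induction j arbitrary: k t)
  case (Suc j)
  then show ?case using lang_ty_mono[OF Suc.prems(2), of "k - 1"] by auto
qed simp

lemma appz_props:
  assumes "1 \<le> m"
  shows "ty (appz (HV KF m k) (NV i) m (m - 1)) = Some 0"
    and "lang_ty b m \<Longrightarrow> lang_ty b (tmax (appz (HV KF m k) (NV i) m (m - 1)))"
    and "fvt (appz G x m j) = {G, x}"
    and "x \<noteq> G \<Longrightarrow> substt x (V y) (appz G x m j) = appz G y m j"
  using assms lang_ty_mono[of b m "m - 1"]
  by (auto simp: appz_def ty_iterap intro!: lang_ty_iterap)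

section \<open>Derivability of Kripke's schema\<close>

lemma deriv_inLang: "deriv b E a \<Longrightarrow> inLang b a"
  by (induction rule: deriv.induct) auto

lemma deriv_weaken:
  assumes "deriv b E a" "inLang b h"
  shows "deriv b E (Im h a)"
proof -
  have "deriv b E (Im a (Im h a))"
    using assms(2) deriv_inLang[OF assms(1)] by (intro deriv.ax lpax.k1) auto
  then show ?thesis by (rule deriv.mp[OF assms(1)])
qed

text \<open>There is no deduction theorem here. Hypotheses are carried along as an antecedent
  \<open>h\<close>, and axiom \<open>k2\<close> performs modus ponens below it.\<close>

lemma deriv_mp_under:
  assumes "deriv b E (Im h (Im a c))" "deriv b E (Im h a)"
  shows "deriv b E (Im h c)"
proof -
  have "deriv b E (Im (Im h (Im a c)) (Im (Im h a) (Im h c)))"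
    using assms[THEN deriv_inLang] by (intro deriv.ax lpax.k2) auto
  then show ?thesis by (rule deriv.mp[OF assms(2) deriv.mp[OF assms(1)]])
qed

lemma deriv_trans:
  assumes "deriv b E (Im p q)" "deriv b E (Im q r)"
  shows "deriv b E (Im p r)"
  using deriv_mp_under[OF deriv_weaken[OF assms(2)] assms(1)] deriv_inLang[OF assms(1)] by simp

lemma deriv_id:
  assumes "inLang b h"
  shows "deriv b E (Im h h)"
proof -
  have "deriv b E (Im h (Im (Im h h) h))" "deriv b E (Im h (Im h h))"
    using assms by (auto intro!: deriv.ax lpax.k1)
  then show ?thesis by (rule deriv_mp_under)
qed

lemma deriv_cj1:
  assumes "deriv b E (Im h (Cj p q))"
  shows "deriv b E (Im h p)"
proof -
  have "deriv b E (Im (Cj p q) p)"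
    using deriv_inLang[OF assms] by (intro deriv.ax lpax.c1) simp
  then show ?thesis by (rule deriv_trans[OF assms])
qed

lemma deriv_cj2:
  assumes "deriv b E (Im h (Cj p q))"
  shows "deriv b E (Im h q)"
proof -
  have "deriv b E (Im (Cj p q) q)"
    using deriv_inLang[OF assms] by (intro deriv.ax lpax.c2) simp
  then show ?thesis by (rule deriv_trans[OF assms])
qed

lemma deriv_cjI:
  assumes "deriv b E (Im h p)" "deriv b E (Im h q)"
  shows "deriv b E (Im h (Cj p q))"
proof -
  have "deriv b E (Im p (Im q (Cj p q)))"
    using assms[THEN deriv_inLang] by (intro deriv.ax lpax.c3) auto
  then show ?thesis by (rule deriv_mp_under[OF deriv_trans[OF assms(1)] assms(2)])
qed

lemma deriv_impI:
  assumes "deriv b E (Im (Cj h p) q)"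
  shows "deriv b E (Im h (Im p q))"
proof -
  note L = assms[THEN deriv_inLang, simplified]
  have 1: "deriv b E (Im h (Im p (Cj h p)))"
    using L by (intro deriv.ax lpax.c3) auto
  have 2: "deriv b E (Im (Im p (Im (Cj h p) q)) (Im (Im p (Cj h p)) (Im p q)))"
    using L by (intro deriv.ax lpax.k2) auto
  have "deriv b E (Im p (Im (Cj h p) q))"
    using assms L by (simp add: deriv_weaken)
  then show ?thesis by (rule deriv_trans[OF 1 deriv.mp[OF _ 2]])
qed

lemma deriv_cj_hyps:
  assumes "inLang b p" "inLang b q"
  shows "deriv b E (Im (Cj p q) p)" "deriv b E (Im (Cj p q) q)"
  using assms deriv_cj1[OF deriv_id] deriv_cj2[OF deriv_id] by simp_all

lemma deriv_impE:
  assumes "deriv b E (Im h (Im p q))"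
  shows "deriv b E (Im (Cj h p) q)"
proof -
  have "inLang b h" "inLang b p" using deriv_inLang[OF assms] by auto
  note hp = deriv_cj_hyps[OF this]
  show ?thesis by (rule deriv_mp_under[OF deriv_trans[OF hp(1) assms] hp(2)])
qed

lemma deriv_swap:
  assumes "deriv b E (Im p (Im q r))"
  shows "deriv b E (Im q (Im p r))"
proof -
  have "inLang b q" "inLang b p" using deriv_inLang[OF assms] by auto
  note qp = deriv_cj_hyps[OF this]
  show ?thesis
    by (rule deriv_impI[OF deriv_trans[OF deriv_cjI[OF qp(2,1)] deriv_impE[OF assms]]])
qed

lemma deriv_trans_under:
  assumes pq: "deriv b E (Im h (Im p q))" and qr: "deriv b E (Im h (Im q r))"
  shows "deriv b E (Im h (Im p r))"
proof -
  have "inLang b h" "inLang b p" using deriv_inLang[OF pq] by auto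
  then have "deriv b E (Im (Cj h p) h)" by (rule deriv_cj_hyps)
  then show ?thesis
    by (intro deriv_impI[OF deriv_mp_under[OF deriv_trans[OF _ qr] deriv_impE[OF pq]]])
qed

text \<open>The rule \<open>exel\<close> acts only on the outermost antecedent, so the two
  antecedents are swapped before and after it.\<close>

lemma deriv_exE_under:
  assumes "deriv b E (Im h (Im p q))" "x \<notin> fvf h" "x \<notin> fvf q" "vwf x" "lang_ty b (vty x)"
  shows "deriv b E (Im h (Im (Exi x p) q))"
  using deriv_swap[OF deriv.exel[OF deriv_swap[OF assms(1)]]] assms deriv_inLang[OF assms(1)]
  by simp

lemma deriv_exI:
  assumes "inst_ok x t" "freefor x t a" "inLang b (subst x t a)" "inLang b (Exi x a)"
  shows "deriv b E (Im (subst x t a) (Exi x a))"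
  using assms by (intro deriv.ax lpax.exi) auto

section \<open>Generalisation, instances of axioms, and the 0/1 value of a decidable formula\<close>

lemma deriv_gen:
  assumes "deriv b E a" "vwf x" "lang_ty b (vty x)"
  shows "deriv b E (Al x a)"
proof -
  \<comment> \<open>The rule \<open>gen\<close> quantifies only below an implication; a provable
    closed antecedent makes it applicable and is detached afterwards.\<close>
  have "deriv b E (Im (Im Bot Bot) (Al x a))"
    using assms deriv_inLang[OF assms(1)] deriv_weaken[OF assms(1), of "Im Bot Bot"]
    by (intro deriv.gen) auto
  then show ?thesis by (rule deriv.mp[rotated]) (simp add: deriv_id)
qed

text \<open>Number-theoretic axioms are stated for variables. Generalising and then using
  \<open>alle\<close> gives their instances for terms.\<close>

lemma deriv_inst:
  assumes "deriv b E a" "inst_ok x t" "freefor x t a" "inLang b (subst x t a)"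
    "vwf x" "lang_ty b (vty x)"
  shows "deriv b E (subst x t a)"
proof -
  have "deriv b E (Im (Al x a) (subst x t a))"
    using assms deriv_inLang[OF assms(1)] by (intro deriv.ax lpax.alle) auto
  then show ?thesis by (rule deriv.mp[OF deriv_gen[OF assms(1,5,6)]])
qed

lemma deriv_zero_eq: "deriv b E (Eq0 Zr Zr)"
proof -
  have "deriv b E (Eq0 (V (NV 0)) (V (NV 0)))"
    using lpax.refl[of "NV 0"] by (intro deriv.ax) (auto simp: eqty_def)
  from deriv_inst[OF this, of "NV 0" Zr] show ?thesis by simp
qed

lemma deriv_one_neq: "deriv b E (Neg (Eq0 (Sc Zr) Zr))"
proof -
  have "deriv b E (Neg (Eq0 (Sc (V (NV 0))) Zr))"
    by (intro deriv.ax lpax.s1) auto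
  from deriv_inst[OF this, of "NV 0" Zr] show ?thesis by simp
qed

lemma deriv_efq:
  assumes "deriv b E (Im h Bot)" "inLang b a"
  shows "deriv b E (Im h a)"
  by (rule deriv_trans[OF assms(1) deriv.ax[OF lpax.efq]]) (simp add: assms)

text \<open>Decidability of \<open>p\<close> gives two cases: the witness is 1 if \<open>p\<close>
  holds and 0 if it fails. This supplies the premise of (C1) for a provability statement, which is
  decidable by (CS1).\<close>

lemma deriv_characteristic:
  assumes p: "deriv b E (Dj p (Neg p))" and y: "NV j \<notin> fvf p"
  shows "deriv b E (Exi (NV j) (Iff p (Neg (Eq0 (V (NV j)) Zr))))" (is "deriv b E ?e")
proof -
  let ?q = "\<lambda>t. Iff p (Neg (Eq0 t Zr))"
  have L: "inLang b p" using deriv_inLang[OF p] by simp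
  have "deriv b E (Im p (Im p (Neg (Eq0 (Sc Zr) Zr))))"
    using L by (simp add: deriv_weaken deriv_one_neq)
  moreover have "deriv b E (Im p (Im (Neg (Eq0 (Sc Zr) Zr)) p))"
    using L by (intro deriv.ax lpax.k1) simp
  ultimately have 1: "deriv b E (Im p (?q (Sc Zr)))"
    unfolding Iff_def by (rule deriv_cjI)
  have "deriv b E (Im (Neg p) (Im p Bot))"
    using deriv_id[of b "Neg p" E] L by (simp add: Neg_def)
  then have a: "deriv b E (Im (Neg p) (Im p (Neg (Eq0 Zr Zr))))"
    using L deriv_impI[OF deriv_efq[OF deriv_impE]] by simp
  \<comment> \<open>For the value 0 the right-hand side of the equivalence is refutable, so it
    implies \<open>p\<close> ex falso.\<close>
  have "deriv b E (Im (Neg (Eq0 Zr Zr)) (Im (Eq0 Zr Zr) Bot))"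
    unfolding Neg_def by (rule deriv_id) simp
  then have "deriv b E (Im (Neg (Eq0 Zr Zr)) Bot)"
    by (rule deriv_mp_under) (simp add: deriv_weaken deriv_zero_eq)
  then have "deriv b E (Im (Neg (Eq0 Zr Zr)) p)"
    using L by (rule deriv_efq)
  then have "deriv b E (Im (Neg p) (Im (Neg (Eq0 Zr Zr)) p))"
    by (rule deriv_weaken) (simp add: L)
  with a have 2: "deriv b E (Im (Neg p) (?q Zr))"
    unfolding Iff_def by (rule deriv_cjI)
  have s: "subst (NV j) t (?q (V (NV j))) = ?q t" for t
    using y by (simp add: subst_fresh)
  have *: "deriv b E (Im (?q t) ?e)" if "ty t = Some 0" "tmax t = 0" for t
    using deriv_exI[of "NV j" t "?q (V (NV j))" b E] that L y unfolding s
    by (simp add: freefor_fresh)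
  have d3: "deriv b E (Im (Im p ?e) (Im (Im (Neg p) ?e) (Im (Dj p (Neg p)) ?e)))"
    using L by (intro deriv.ax lpax.d3) auto
  have e: "deriv b E (Im p ?e)" "deriv b E (Im (Neg p) ?e)"
    using deriv_trans[OF 1 *] deriv_trans[OF 2 *] by simp_all
  show ?thesis by (rule deriv.mp[OF p deriv.mp[OF e(2) deriv.mp[OF e(1) d3]]])
qed

section \<open>Derivation of the schema from (C1) and (CS1)-(CS3)\<close>

lemma sortf_le_iff: "sortf a \<le> m \<longleftrightarrow> (\<forall>v\<in>fvf a. vty v \<le> m)"
  by (simp add: sortf_def)

lemma deriv_ks:
  assumes "ks a" "inLang b a"
  shows "deriv b Cset a"
  using assms
proof (cases rule: ks.cases)
  case (1 p G m k x i)
  have m: "1 \<le> m" "sortf p \<le> m" using 1 by auto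
  have Lm: "lang_ty b m" and Lp: "inLang b p"
    using 1 \<open>inLang b a\<close> by auto
  \<comment> \<open>The bound variable \<open>x\<close> of the schema may occur free in
    \<open>p\<close>. Hence (CS3) is applied with a fresh index \<open>i'\<close>, and a further
    fresh \<open>j\<close> names the 0/1 value in (C1).\<close>
  have "finite (NV -` fvf p)"
    by (rule finite_vimageI) (auto simp: inj_def)
  then obtain i' where i': "NV i' \<notin> fvf p"
    using ex_new_if_finite[OF infinite_UNIV_nat] by blast
  have "finite (insert i' (NV -` fvf p))"
    using \<open>finite (NV -` fvf p)\<close> by simp
  then obtain j where j: "NV j \<notin> fvf p" "j \<noteq> i'"
    using ex_new_if_finite[OF infinite_UNIV_nat] by blast
  define P where "P = Prf (V (NV i')) p"
  define N where "N = (\<lambda>t. Neg (Eq0 t Zr))"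
  define t where "t = (\<lambda>x. appz G x m (m - 1))"
  \<comment> \<open>\<open>h\<close> is the matrix of the conclusion of (C1): \<open>G\<close>
    decides, stage by stage, whether \<open>p\<close> has been proved.\<close>
  define h where "h = Al (NV i') (Iff P (N (t (NV i'))))"
  have LP: "inLang b P" using Lp \<open>isL p\<close> by (simp add: P_def)
  have LN: "inLang b (N (t (NV l)))" for l
    using appz_props[OF m(1)] Lm 1 by (simp add: N_def t_def)
  have fN: "fvf (N (t (NV l))) = {G, NV l}" for l
    using appz_props(3)[OF m(1)] by (simp add: N_def t_def)
  have sN: "subst (NV l) (V (NV l')) (N (t (NV l))) = N (t (NV l'))" for l l'
    using appz_props(4)[OF m(1)] 1 by (simp add: N_def t_def)
  have fnN: "freefor z r (N q)" for z r q by (simp add: N_def)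
  have G: "vwf G" "vty G = m" "G \<noteq> NV l" for l using 1 m by auto
  have "deriv b Cset (Dj P (Neg P))"
    using LP \<open>isL p\<close> unfolding P_def by (intro deriv.ax lpax.cs1) auto
  then have "deriv b Cset (Exi (NV j) (Iff P (N (V (NV j)))))"
    unfolding N_def using j by (intro deriv_characteristic) (auto simp: P_def)
  then have "deriv b Cset (Al (NV i') (Exi (NV j) (Iff P (N (V (NV j))))))"
    by (rule deriv_gen) auto
  moreover have "deriv b Cset (Im (Al (NV i') (Exi (NV j) (Iff P (N (V (NV j)))))) (Exi G h))"
  \<comment> \<open>The formula to which (C1) is applied adds only number variables to those of
    \<open>p\<close>, so its sort is still at most \<open>m\<close>.\<close>
  proof (rule deriv.hyp)
    have s: "h = Al (NV i') (subst (NV j) (appz G (NV i') m (m - 1)) (Iff P (N (V (NV j)))))"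
      using j by (simp add: h_def P_def N_def t_def subst_fresh)
    show "Im (Al (NV i') (Exi (NV j) (Iff P (N (V (NV j)))))) (Exi G h) \<in> Cset"
      unfolding Cset_def mem_Collect_eq s
      using 1 m j by (intro cax.C1[where i=i' and j=j and k=k]) (auto simp: P_def N_def sortf_le_iff freefor_fresh)
    show "inLang b (Im (Al (NV i') (Exi (NV j) (Iff P (N (V (NV j)))))) (Exi G h))"
      using LP LN G Lm by (simp add: h_def) (simp add: N_def)
  qed
  ultimately have exG: "deriv b Cset (Exi G h)"
    by (rule deriv.mp)
  have Lh: "inLang b h" using LP LN by (simp add: h_def)
  have "deriv b Cset (Im (Al (NV i') (Iff P (N (t (NV i')))))
      (subst (NV i') (V (NV i')) (Iff P (N (t (NV i'))))))"
    using LP LN by (intro deriv.ax lpax.alle) auto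
  then have hPN: "deriv b Cset (Im h (Cj (Im P (N (t (NV i')))) (Im (N (t (NV i'))) P)))"
    by (simp add: h_def Iff_def)
  \<comment> \<open>With two indices this also renames the bound variable, which mediates between
    \<open>x\<close> and the fresh \<open>i'\<close>.\<close>
  have exN: "deriv b Cset (Im (N (t (NV l))) (Exi (NV l') (N (t (NV l')))))" for l l'
    using deriv_exI[of "NV l'" "V (NV l)" "N (t (NV l'))" b Cset] LN fnN unfolding sN by simp
  have fh: "NV i' \<notin> fvf h" by (simp add: h_def)
  have cs3: "deriv b Cset (Iff (Exi (NV i') P) p)"
    using LP Lp i' \<open>isL p\<close> unfolding P_def by (intro deriv.ax lpax.cs3) auto
  then have cs3': "deriv b Cset (Im h (Iff (Exi (NV i') P) p))"
    using Lh by (rule deriv_weaken)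
  have "deriv b Cset (Im h (Im (Exi (NV i') P) (Exi x (N (t x)))))"
  proof (rule deriv_exE_under)
    show "deriv b Cset (Im h (Im P (Exi x (N (t x)))))"
      unfolding \<open>x = NV i\<close>
      by (rule deriv_impI[OF deriv_trans[OF deriv_impE[OF deriv_cj1[OF hPN]] exN]])
  qed (use fh 1 G fN in auto)
  moreover have "deriv b Cset (Im h (Im p (Exi (NV i') P)))"
    using cs3' unfolding Iff_def by (rule deriv_cj2)
  ultimately have to: "deriv b Cset (Im h (Im p (Exi x (N (t x)))))"
    by (rule deriv_trans_under[rotated])
  have "deriv b Cset (Im h (Im (N (t (NV i'))) p))"
  proof (rule deriv_impI)
    have "deriv b Cset (Im P (Exi (NV i') P))"
      using deriv_exI[of "NV i'" "V (NV i')" P b Cset] LP by simp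
    moreover have "deriv b Cset (Im (Exi (NV i') P) p)"
      using deriv.mp[OF cs3[unfolded Iff_def] deriv.ax[OF lpax.c1]] LP Lp by simp
    ultimately show "deriv b Cset (Im (Cj h (N (t (NV i')))) p)"
      by (rule deriv_trans[OF deriv_impE[OF deriv_cj2[OF hPN]] deriv_trans])
  qed
  then have "deriv b Cset (Im h (Im (Exi (NV i') (N (t (NV i')))) p))"
    using fh i' by (intro deriv_exE_under) auto
  moreover have "deriv b Cset (Im h (Im (Exi x (N (t x))) (Exi (NV i') (N (t (NV i'))))))"
    using exN[of i i'] fN LN G \<open>x = NV i\<close> Lh by (intro deriv_weaken[OF deriv.exel]) auto
  ultimately have "deriv b Cset (Im h (Im (Exi x (N (t x))) p))"
    by (rule deriv_trans_under[rotated])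
  with to have "deriv b Cset (Im h (Iff p (Exi x (N (t x)))))"
    unfolding Iff_def by (rule deriv_cjI)
  moreover have "a = Exi G (Iff p (Exi x (N (t x))))"
    using 1 by (simp add: N_def t_def)
  \<comment> \<open>\<open>G\<close> itself is the witness. Afterwards \<open>G\<close> is no longer
    free on the right, so it can be eliminated from \<open>h\<close> on the left.\<close>
  then have "deriv b Cset (Im (Iff p (Exi x (N (t x)))) a)"
    using deriv_exI[of G "V G" "Iff p (Exi x (N (t x)))" b Cset] 1 \<open>inLang b a\<close> m by simp
  ultimately have "deriv b Cset (Im h a)"
    by (rule deriv_trans)
  then have "deriv b Cset (Im (Exi G h) a)"
    using 1 G Lm Lh \<open>inLang b a\<close> by (intro deriv.exel) auto
  with exG show ?thesis by (rule deriv.mp)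
qed

section \<open>Nodes and paths\<close>

lemma prefix_iff_nth: "prefix p q \<longleftrightarrow> length p \<le> length q \<and> (\<forall>j<length p. p ! j = q ! j)"
proof
  assume r: "length p \<le> length q \<and> (\<forall>j<length p. p ! j = q ! j)"
  then have "p = take (length p) q"
    by (intro nth_equalityI) auto
  then show "prefix p q" by (metis take_is_prefix)
qed (auto simp: prefix_def nth_append)

definition trunc :: "nat \<Rightarrow> 'u node \<Rightarrow> 'u node" where
  "trunc n = map (take n)"

lemma dset_iff:
  "x \<in> dset A k \<longleftrightarrow> length x = Suc k \<and> (\<forall>i<Suc k. length (x ! i) = lh x \<and> set (x ! i) \<subseteq> A i)"
proof
  assume "x \<in> dset A k"
  then obtain m where m: "length x = Suc k" "\<forall>i<Suc k. length (x ! i) = m \<and> set (x ! i) \<subseteq> A i"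
    by (auto simp: dset_def)
  moreover have "lh x = m" using m by (simp add: lh_def)
  ultimately show "length x = Suc k \<and> (\<forall>i<Suc k. length (x ! i) = lh x \<and> set (x ! i) \<subseteq> A i)"
    by simp
qed (auto simp: dset_def)

lemma ext_refl [simp]: "ext x x"
  by (simp add: ext_def)

lemma ext_trans: "ext x y \<Longrightarrow> ext y z \<Longrightarrow> ext x z"
  unfolding ext_def by (metis prefix_order.trans)

lemma trunc_trunc: "trunc n (trunc m x) = trunc (min n m) x"
  by (simp add: trunc_def min.commute)

lemma ext_trunc: "ext x (trunc n x)"
  by (simp add: ext_def trunc_def take_is_prefix)

lemma lh_trunc: "x \<in> dset A k \<Longrightarrow> lh (trunc n x) = min n (lh x)"
  by (auto simp: dset_def lh_def trunc_def)

lemma trunc_dset: "x \<in> dset A k \<Longrightarrow> trunc n x \<in> dset A k"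
  using lh_trunc[of x A k n] by (auto simp: dset_iff trunc_def dest: in_set_takeD)

text \<open>Turns extension into an equation, so that comparing nodes becomes a computation with
  lengths and truncations.\<close>

lemma ext_iff_trunc:
  assumes "x \<in> dset A k" "y \<in> dset A k"
  shows "ext y x \<longleftrightarrow> x = trunc (lh x) y"
proof
  assume e: "ext y x"
  show "x = trunc (lh x) y"
  proof (rule nth_equalityI)
    show "length x = length (trunc (lh x) y)" using assms by (simp add: trunc_def dset_iff)
    fix i assume i: "i < length x"
    then have "prefix (x ! i) (y ! i)" using e by (simp add: ext_def)
    moreover have "length (x ! i) = lh x" using i assms by (simp add: dset_iff)
    ultimately have "x ! i = take (lh x) (y ! i)" by (auto simp: prefix_def)
    then show "x ! i = trunc (lh x) y ! i"
      using i assms by (simp add: trunc_def dset_iff)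
  qed
next
  assume "x = trunc (lh x) y"
  then show "ext y x" using ext_trunc by metis
qed

lemma trunc_lh: "x \<in> dset A k \<Longrightarrow> trunc (lh x) x = x"
  using ext_iff_trunc ext_refl by metis

lemma trunc_ext:
  assumes "x \<in> dset A k" "y \<in> dset A k" "ext y x" "n \<le> lh x"
  shows "trunc n y = trunc n x"
  using assms ext_iff_trunc[OF assms(1,2)] by (metis trunc_trunc min.absorb1)

lemma lh_ext:
  assumes "x \<in> dset A k" "y \<in> dset A k" "ext y x"
  shows "lh x \<le> lh y"
  using assms ext_iff_trunc[OF assms(1,2)] lh_trunc[OF assms(2), of "lh x"]
  by (metis min.cobounded2)

text \<open>The order is that of a tree: \<open>x\<close> and \<open>y\<close> are both truncations
  of \<open>z\<close>, so the shorter one is a truncation of the longer one.\<close>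

lemma ext_common:
  assumes "x \<in> dset A k" "y \<in> dset A k" "z \<in> dset A k" "ext z x" "ext z y" "lh x \<le> lh y"
  shows "ext y x"
  using assms ext_iff_trunc by (metis trunc_ext)

lemma take_dset: "a \<in> dset A k \<Longrightarrow> 1 \<le> n \<Longrightarrow> n \<le> Suc k \<Longrightarrow> take n a \<in> dset A (n - 1)"
  by (auto simp: dset_def)

lemma take_trunc: "take n (trunc j a) = trunc j (take n a)"
  by (simp add: trunc_def take_map)

lemma lh_take: "1 \<le> n \<Longrightarrow> lh (take n a) = lh a"
  by (simp add: lh_def)

lemma ext_take: "ext c b \<Longrightarrow> ext (take n c) (take n b)"
  by (simp add: ext_def)

lemma root_dset: "replicate (Suc k) [] \<in> dset A k"
  unfolding dset_def by (auto simp del: replicate_Suc)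

lemma ext_root: "x \<in> dset A k \<Longrightarrow> ext x (replicate (Suc k) [])"
  by (auto simp: ext_def dset_iff simp del: replicate_Suc)

section \<open>Maximal chains of nodes\<close>

lemma paths_dset: "P \<in> paths D \<Longrightarrow> x \<in> P \<Longrightarrow> x \<in> D"
  by (auto simp: paths_def)

lemma paths_linear: "P \<in> paths D \<Longrightarrow> x \<in> P \<Longrightarrow> y \<in> P \<Longrightarrow> ext x y \<or> ext y x"
  by (auto simp: paths_def)

lemma paths_maximal: "P \<in> paths D \<Longrightarrow> z \<in> D \<Longrightarrow> (\<And>x. x \<in> P \<Longrightarrow> ext z x \<or> ext x z) \<Longrightarrow> z \<in> P"
  by (auto simp: paths_def)

lemma root_in_path: "P \<in> paths (dset A k) \<Longrightarrow> replicate (Suc k) [] \<in> P"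
  using paths_maximal root_dset ext_root paths_dset by metis

text \<open>By maximality it suffices to compare \<open>x\<close> with each \<open>z\<close> in the
  chain. If \<open>z\<close> is later than \<open>y\<close>, it is later than \<open>x\<close>;
  otherwise \<open>x\<close> and \<open>z\<close> are both truncations of \<open>y\<close>.\<close>

lemma paths_downward:
  assumes P: "P \<in> paths (dset A k)" and "y \<in> P" "x \<in> dset A k" "ext y x"
  shows "x \<in> P"
proof (rule paths_maximal[OF P \<open>x \<in> dset A k\<close>])
  fix z assume z: "z \<in> P"
  note d = paths_dset[OF P]
  from paths_linear[OF P z \<open>y \<in> P\<close>] show "ext x z \<or> ext z x"
  proof
    assume "ext z y"
    then show ?thesis using ext_trans assms by blast
  next
    assume "ext y z"
    then show ?thesis
      using ext_common[OF _ _ d[OF \<open>y \<in> P\<close>]] assms d[OF z] by (metis nle_le)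
  qed
qed

text \<open>If the chain had no node of length \<open>Suc n\<close>, then its node \<open>x\<close>
  of length \<open>n\<close> would be later than all others. Any one-step extension of
  \<open>x\<close> would be comparable with the whole chain, against maximality.\<close>

lemma paths_length:
  assumes P: "P \<in> paths (dset A k)" and A: "\<And>i. i \<le> k \<Longrightarrow> A i \<noteq> {}"
  shows "\<exists>x\<in>P. lh x = n"
proof (induction n)
  case 0
  show ?case using bexI[OF _ root_in_path[OF P]] by (simp add: lh_def)
next
  case (Suc n)
  note d = paths_dset[OF P]
  from Suc obtain x where x: "x \<in> P" "lh x = n" by blast
  show ?case
  proof (rule ccontr)
    assume no: "\<not> ?thesis"
    have short: "lh z \<le> n" if "z \<in> P" for z
    proof (rule ccontr)
      assume "\<not> lh z \<le> n"
      then have "lh (trunc (Suc n) z) = Suc n"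
        using lh_trunc[OF d[OF that]] by simp
      moreover have "trunc (Suc n) z \<in> P"
        using paths_downward[OF P that trunc_dset[OF d[OF that]] ext_trunc] .
      ultimately show False using no by blast
    qed
    have xz: "ext x z" if z: "z \<in> P" for z
      using paths_linear[OF P x(1) z] ext_common[OF d[OF z] d[OF x(1)] d[OF z]] short[OF z] x(2)
      by auto
    \<comment> \<open>Any labels will do, so an arbitrary element of each domain is
      appended.\<close>
    define y where "y = map (\<lambda>i. x ! i @ [SOME u. u \<in> A i]) [0..<Suc k]"
    have y0: "length y = Suc k" "lh y = Suc n"
      using x by (auto simp: y_def lh_def simp del: upt_Suc)
    have yi: "y ! i = x ! i @ [SOME u. u \<in> A i]" if "i < Suc k" for i
      using that by (simp add: y_def del: upt_Suc)
    have "(SOME u. u \<in> A i) \<in> A i" if "i < Suc k" for i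
      using A[of i] that by (simp add: some_in_eq)
    then have yd: "y \<in> dset A k"
      using y0 yi d[OF x(1)] x(2) by (auto simp: dset_iff)
    have "ext y x"
      using y0 yi d[OF x(1)] by (auto simp: ext_def dset_iff)
    then have "y \<in> P"
      using paths_maximal[OF P yd] xz ext_trans by blast
    then show False using no y0 by blast
  qed
qed

lemma path_through:
  assumes a: "a \<in> dset A k" and A: "\<And>i. i \<le> k \<Longrightarrow> A i \<noteq> {}"
  shows "\<exists>P\<in>paths (dset A k). a \<in> P"
proof -
  \<comment> \<open>The nodes \<open>r n\<close> are the truncations of \<open>a\<close> continued
    for ever by default labels. Padding with \<open>n\<close> labels before \<open>take n\<close>
    guarantees length \<open>n\<close> for every \<open>n\<close>.\<close>
  define r where "r n = map (\<lambda>i. take n (a ! i @ replicate n (SOME u. u \<in> A i))) [0..<Suc k]" for n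
  have r0: "length (r n) = Suc k" "lh (r n) = n" for n
    by (auto simp: r_def lh_def simp del: upt_Suc)
  have ri: "r n ! i = take n (a ! i @ replicate n (SOME u. u \<in> A i))" if "i < Suc k" for i n
    using that by (simp add: r_def del: upt_Suc)
  have u: "(SOME u. u \<in> A i) \<in> A i" if "i < Suc k" for i
    using A[of i] that by (simp add: some_in_eq)
  have rd: "r n \<in> dset A k" for n
    using r0 ri u a by (fastforce simp: dset_iff dest: in_set_takeD)
  have rr: "trunc n (r m) = r n" if "n \<le> m" for n m
    using that r0 by (intro nth_equalityI) (auto simp: trunc_def ri min_def)
  have re: "ext (r m) (r n)" if "n \<le> m" for n m
    using ext_trunc rr[OF that] by metis
  have "range r \<in> paths (dset A k)"
    unfolding paths_def mem_Collect_eq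
  proof (intro conjI ballI impI)
    show "range r \<subseteq> dset A k" using rd by auto
  next
    fix x y assume "x \<in> range r" "y \<in> range r"
    then show "ext x y \<or> ext y x" using re by (metis imageE nle_le)
  next
    \<comment> \<open>A node comparable with the member of its own length is equal to it.\<close>
    fix z assume z: "z \<in> dset A k" "\<forall>x\<in>range r. ext z x \<or> ext x z"
    then have "ext z (r (lh z)) \<or> ext (r (lh z)) z" by blast
    then have "z = r (lh z)"
      using ext_iff_trunc[OF z(1) rd] ext_iff_trunc[OF rd z(1)] trunc_lh[OF z(1)]
        trunc_lh[OF rd] r0(2) by metis
    then show "z \<in> range r" by blast
  qed
  moreover have "a = r (lh a)"
    using a r0 by (intro nth_equalityI) (auto simp: ri dset_iff)
  ultimately show ?thesis by blast
qed

section \<open>Monotone and complete functions on nodes\<close>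

lemma validfn_Suc:
  "validfn A (Suc k) g \<longleftrightarrow>
    (\<forall>x n. x \<notin> dset A k \<longrightarrow> g x n = None) \<and>
    (\<forall>x n v. g x n = Some v \<longrightarrow> v \<in> A k) \<and>
    (\<forall>x\<in>dset A k. \<forall>y\<in>dset A k. ext y x \<longrightarrow> (\<forall>n v. g x n = Some v \<longrightarrow> g y n = Some v)) \<and>
    (\<forall>P\<in>paths (dset A k). \<forall>n. \<exists>x\<in>P. g x n \<noteq> None)"
  by (simp add: validfn_def)

lemma
  assumes "validfn A (Suc k) g"
  shows validfn_undef: "x \<notin> dset A k \<Longrightarrow> g x n = None"
    and validfn_mem: "g x n = Some v \<Longrightarrow> v \<in> A k"
    and validfn_mono: "x \<in> dset A k \<Longrightarrow> y \<in> dset A k \<Longrightarrow> ext y x \<Longrightarrow> g x n = Some v \<Longrightarrow> g y n = Some v"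
    and validfn_complete: "P \<in> paths (dset A k) \<Longrightarrow> \<exists>x\<in>P. g x n \<noteq> None"
proof -
  note g = assms[unfolded validfn_Suc]
  show "x \<notin> dset A k \<Longrightarrow> g x n = None"
    using g[THEN conjunct1] by blast
  show "g x n = Some v \<Longrightarrow> v \<in> A k"
    using g[THEN conjunct2, THEN conjunct1] by blast
  show "x \<in> dset A k \<Longrightarrow> y \<in> dset A k \<Longrightarrow> ext y x \<Longrightarrow> g x n = Some v \<Longrightarrow> g y n = Some v"
    using g[THEN conjunct2, THEN conjunct2, THEN conjunct1] by blast
  show "P \<in> paths (dset A k) \<Longrightarrow> \<exists>x\<in>P. g x n \<noteq> None"
    using g[THEN conjunct2, THEN conjunct2, THEN conjunct2] by blast
qed

text \<open>Serves two constructions: the successor functionals, with \<open>\<sigma>\<close> the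
  identity, and the action of an automorphism, with \<open>\<sigma>\<close> a relabelling of
  nodes.\<close>

lemma validfn_map:
  assumes g: "validfn A (Suc k) g" and h: "\<And>u. u \<in> A k \<Longrightarrow> h u \<in> A k"
    and \<sigma>: "\<And>x. \<sigma> x \<in> dset A k \<longleftrightarrow> x \<in> dset A k" "\<And>x y. ext y x \<Longrightarrow> ext (\<sigma> y) (\<sigma> x)"
      "\<And>P. P \<in> paths (dset A k) \<Longrightarrow> \<sigma> ` P \<in> paths (dset A k)"
  shows "validfn A (Suc k) (\<lambda>x n. map_option h (g (\<sigma> x) n))"
  unfolding validfn_Suc
proof (intro conjI allI impI ballI)
  fix P n assume "P \<in> paths (dset A k)"
  then have "\<exists>x\<in>\<sigma> ` P. g x n \<noteq> None"
    using validfn_complete[OF g \<sigma>(3)] by blast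
  then show "\<exists>x\<in>P. map_option h (g (\<sigma> x) n) \<noteq> None" by auto
next
  fix x y n v
  assume "x \<in> dset A k" "y \<in> dset A k" "ext y x" "map_option h (g (\<sigma> x) n) = Some v"
  moreover from this obtain w where "g (\<sigma> x) n = Some w" "v = h w" by auto
  ultimately show "map_option h (g (\<sigma> y) n) = Some v"
    using validfn_mono[OF g, of "\<sigma> x" "\<sigma> y" n w] \<sigma>(1,2) by simp
next
  show "map_option h (g (\<sigma> x) n) = None" if "x \<notin> dset A k" for x n
    using validfn_undef[OF g] \<sigma>(1) that by simp
next
  show "v \<in> A k" if "map_option h (g (\<sigma> x) n) = Some v" for x n v
    using that validfn_mem[OF g] h by auto
qed

lemma fvt_bound: "ty t = Some k \<Longrightarrow> v \<in> fvt t \<Longrightarrow> vwf v \<and> vty v \<le> tmax t"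
  by (induction t arbitrary: k) (auto split: if_splits simp: le_max_iff_disj)

lemma fvf_bound: "wf p \<Longrightarrow> v \<in> fvf p \<Longrightarrow> vwf v \<and> vty v \<le> fmax p"
  by (induction p) (auto simp: le_max_iff_disj dest: fvt_bound)

section \<open>Forcing in the Beth model\<close>

locale beth =
  fixes s :: nat and num :: "nat \<Rightarrow> 'u" and A :: "nat \<Rightarrow> 'u set"
    and app :: "'u \<Rightarrow> 'u node \<Rightarrow> nat \<Rightarrow> 'u option"
  assumes s_pos: "1 \<le> s" and univ: "beth_univ s num A app"
begin

section \<open>The domains, constants and successor functionals of the model\<close>

abbreviation nodes :: "'u node set" where
  "nodes \<equiv> dset A (s - 1)"

lemma inv_num [simp]: "inv num (num n) = n"
  using univ by (simp add: beth_univ_def)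

lemma A_0: "A 0 = range num"
  using univ by (simp add: beth_univ_def)

lemma app_bij: "Suc k \<le> s \<Longrightarrow> bij_betw app (A (Suc k)) {g. validfn A (Suc k) g}"
  using univ by (simp add: beth_univ_def)

lemma app_valid: "Suc k \<le> s \<Longrightarrow> f \<in> A (Suc k) \<Longrightarrow> validfn A (Suc k) (app f)"
  using app_bij bij_betwE by blast

lemma app_eqI:
  "Suc k \<le> s \<Longrightarrow> f \<in> A (Suc k) \<Longrightarrow> g \<in> A (Suc k) \<Longrightarrow> (\<And>x n. app f x n = app g x n) \<Longrightarrow> f = g"
  using app_bij[of k] by (metis bij_betw_imp_inj_on inj_onD ext)

text \<open>Since \<open>app\<close> is a bijection onto the valid functions, each of them has
  exactly one code. This makes every later \<open>THE\<close> a proper description.\<close>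

lemma the_functional:
  assumes "Suc k \<le> s" "validfn A (Suc k) h"
  defines "g \<equiv> THE g. g \<in> A (Suc k) \<and> (\<forall>x n. app g x n = h x n)"
  shows "g \<in> A (Suc k)" "app g x n = h x n"
proof -
  have "\<exists>g\<in>A (Suc k). app g = h"
    using bij_betw_imp_surj_on[OF app_bij[OF assms(1)]] assms(2) by (metis imageE mem_Collect_eq)
  then have "\<exists>!g. g \<in> A (Suc k) \<and> (\<forall>x n. app g x n = h x n)"
    using app_eqI[OF assms(1)] by (intro ex_ex1I) (blast, metis)
  from theI'[OF this] show "g \<in> A (Suc k)" "app g x n = h x n"
    unfolding g_def by auto
qed

text \<open>Applying \<open>const i k\<close> to \<open>k\<close> arguments gives the number
  \<open>i\<close>. For \<open>i = 0\<close> this is the interpretation of K; together with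
  \<open>i = 1\<close> it supplies the values of the functional that witnesses Kripke's
  schema.\<close>

primrec const :: "nat \<Rightarrow> nat \<Rightarrow> 'u" where
  "const i 0 = num i"
| "const i (Suc k) = (THE f. f \<in> A (Suc k) \<and>
     (\<forall>x n. app f x n = (if x \<in> dset A k then Some (const i k) else None)))"

lemma const_valid:
  assumes "u \<in> A k"
  shows "validfn A (Suc k) (\<lambda>x n. if x \<in> dset A k then Some u else None)"
proof -
  have "\<forall>P\<in>paths (dset A k). \<exists>x\<in>P. x \<in> dset A k"
    using root_in_path root_dset by blast
  then show ?thesis using assms unfolding validfn_Suc by simp
qed

lemma const_mem: "k \<le> s \<Longrightarrow> const i k \<in> A k"
proof (induction k)
  case 0
  then show ?case by (simp add: A_0)
next
  case (Suc k)
  then show ?case using the_functional(1)[OF _ const_valid] by simp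
qed

lemma app_const:
  "Suc k \<le> s \<Longrightarrow> app (const i (Suc k)) x n = (if x \<in> dset A k then Some (const i k) else None)"
  using the_functional(2)[OF _ const_valid[OF const_mem]] by simp

lemma A_nonempty: "k \<le> s \<Longrightarrow> A k \<noteq> {}"
  using const_mem by blast

lemma Khat_const: "Khat num A app k = const 0 k"
  by (induction k) auto

lemma Shat_mem: "k \<le> s \<Longrightarrow> f \<in> A k \<Longrightarrow> Shat num A app k f \<in> A k"
  and app_Shat: "Suc k \<le> s \<Longrightarrow> f \<in> A (Suc k) \<Longrightarrow>
    app (Shat num A app (Suc k) f) x n = map_option (Shat num A app k) (app f x n)"
proof -
  have valid: "validfn A (Suc k) (\<lambda>x n. map_option (Shat num A app k) (app f x n))"
    if "Suc k \<le> s" "f \<in> A (Suc k)" "\<And>f. f \<in> A k \<Longrightarrow> Shat num A app k f \<in> A k" for k f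
    using validfn_map[OF app_valid[OF that(1,2)], of "Shat num A app k" "\<lambda>x. x"] that(3) by simp
  \<comment> \<open>Closure at type \<open>k\<close> is what makes the candidate at type
    \<open>Suc k\<close> valid, so membership is proved first, by induction.\<close>
  have mem: "k \<le> s \<Longrightarrow> f \<in> A k \<Longrightarrow> Shat num A app k f \<in> A k" for k f
  proof (induction k arbitrary: f)
    case 0
    then show ?case by (simp add: A_0)
  next
    case (Suc k)
    then show ?case using the_functional(1)[OF _ valid] by simp
  qed
  show "k \<le> s \<Longrightarrow> f \<in> A k \<Longrightarrow> Shat num A app k f \<in> A k" by (rule mem)
  show "Suc k \<le> s \<Longrightarrow> f \<in> A (Suc k) \<Longrightarrow>
    app (Shat num A app (Suc k) f) x n = map_option (Shat num A app k) (app f x n)"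
    using the_functional(2)[OF _ valid] mem by simp
qed

section \<open>Evaluation of terms\<close>

lemma vdom_subset: "vdom A app x \<subseteq> A (vty x)"
  by (cases "(A, app, x)" rule: vdom.cases) (auto simp: bset_def lset_def)

text \<open>Weaker than \<open>admissible\<close>: a lawlike or lawless variable may have any value
  of its type. The lemmas on evaluation and forcing need only this much.\<close>

definition typed_env :: "(var \<Rightarrow> 'u) \<Rightarrow> bool" where
  "typed_env e \<longleftrightarrow> (\<forall>v. vwf v \<and> vty v \<le> s \<longrightarrow> e v \<in> A (vty v))"

lemma typed_env_upd: "typed_env e \<Longrightarrow> d \<in> vdom A app x \<Longrightarrow> typed_env (e(x := d))"
  using vdom_subset by (auto simp: typed_env_def)

lemma take_node: "a \<in> nodes \<Longrightarrow> 1 \<le> n \<Longrightarrow> n \<le> s \<Longrightarrow> take n a \<in> dset A (n - 1)"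
  by (rule take_dset) auto

lemma evalt_mem:
  assumes "typed_env e" "a \<in> nodes"
  shows "ty t = Some k \<Longrightarrow> tmax t \<le> s \<Longrightarrow> evalt num A app e a t = Some u \<Longrightarrow> u \<in> A k"
proof (induction t arbitrary: k u)
  case (Ap n f t)
  then obtain w i where "evalt num A app e a f = Some w" "app w (take n a) i = Some u"
    by (auto split: option.splits)
  moreover from this have "w \<in> A n" using Ap by (auto split: if_splits)
  moreover obtain n' where "n = Suc n'" using Ap by (cases n) auto
  ultimately show ?case
    using validfn_mem[OF app_valid[of n' w]] Ap.prems by (auto split: if_splits)
qed (use assms in \<open>auto simp: typed_env_def Khat_const const_mem Shat_mem A_0
       split: if_splits option.splits\<close>)

lemma evalt_mono:
  assumes "typed_env e" "a \<in> nodes" "b \<in> nodes" "ext b a"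
  shows "ty t = Some k \<Longrightarrow> tmax t \<le> s \<Longrightarrow> evalt num A app e a t = Some u \<Longrightarrow>
    evalt num A app e b t = Some u"
proof (induction t arbitrary: k u)
  case (Ap n f t)
  then obtain w i where w: "evalt num A app e a f = Some w" "evalt num A app e a t = Some i"
    "app w (take n a) (inv num i) = Some u"
    by (auto split: option.splits)
  from w(1) have wA: "w \<in> A n" using Ap.prems evalt_mem[OF assms(1,2)] by (auto split: if_splits)
  obtain n' where n': "n = Suc n'" using Ap by (cases n) auto
  have ns: "Suc n' \<le> s" using n' Ap.prems by simp
  have "take n a \<in> dset A n'" "take n b \<in> dset A n'"
    using take_node[of _ n] assms n' ns by auto
  from validfn_mono[OF app_valid[OF ns] this ext_take[OF assms(4)] w(3)]
  have "app w (take n b) (inv num i) = Some u"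
    using wA n' by simp
  moreover have "evalt num A app e b f = Some w" "evalt num A app e b t = Some i"
    using Ap w by (auto split: if_splits)
  ultimately show ?case by simp
qed (auto split: if_splits option.splits)

section \<open>Bars, monotonicity and locality of forcing\<close>

lemma node_path: "a \<in> nodes \<Longrightarrow> \<exists>P\<in>paths nodes. a \<in> P"
  by (rule path_through) (use A_nonempty s_pos in auto)

lemma path_beyond:
  assumes "P \<in> paths nodes" "a \<in> P"
  shows "\<exists>b\<in>P. ext b a \<and> n \<le> lh b"
proof -
  have "i \<le> s - 1 \<Longrightarrow> A i \<noteq> {}" for i using A_nonempty by simp
  \<comment> \<open>A node of the path at least as long as \<open>a\<close> and comparable with
    \<open>a\<close> must extend \<open>a\<close>.\<close>
  then obtain b where b: "b \<in> P" "lh b = max n (lh a)"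
    using paths_length[OF assms(1)] by blast
  have "ext b a"
    using paths_linear[OF assms(1) b(1) assms(2)] b paths_dset[OF assms(1)] assms(2)
      ext_common[of a _ _ b a] lh_ext by (metis ext_refl max.cobounded2)
  then show ?thesis using b by auto
qed

lemma barredI_self: "Q a \<Longrightarrow> barred s A a Q"
  unfolding barred_def using ext_refl by blast

lemma barred_barred: "barred s A a (\<lambda>b. barred s A b Q) \<Longrightarrow> barred s A a Q"
  unfolding barred_def using ext_trans by meson

lemma barred_conv: "barred s A a Q \<Longrightarrow> (\<And>b. b \<in> nodes \<Longrightarrow> Q b \<Longrightarrow> R b) \<Longrightarrow> barred s A a R"
  unfolding barred_def using paths_dset by meson

text \<open>A path through \<open>b\<close> also passes through \<open>a\<close>, so it meets the
  bar. If it does so before \<open>b\<close>, then \<open>Q\<close> is carried forward to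
  \<open>b\<close>.\<close>

lemma barred_mono:
  assumes Q: "\<And>c d. c \<in> nodes \<Longrightarrow> d \<in> nodes \<Longrightarrow> ext d c \<Longrightarrow> Q c \<Longrightarrow> Q d"
    and ab: "a \<in> nodes" "b \<in> nodes" "ext b a" "barred s A a Q"
  shows "barred s A b Q"
  unfolding barred_def
proof (intro ballI impI)
  fix P assume P: "P \<in> paths nodes" "b \<in> P"
  then have "a \<in> P" using paths_downward ab by blast
  then obtain c where c: "c \<in> P" "Q c" using ab P unfolding barred_def by blast
  from paths_linear[OF P(1) c(1) P(2)] show "\<exists>c\<in>P. ext c b \<and> Q c"
    using c Q[of c b] P ab paths_dset[OF P(1)] ext_refl by blast
qed

abbreviation frc :: "frm \<Rightarrow> 'u node \<Rightarrow> (var \<Rightarrow> 'u) \<Rightarrow> bool" where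
  "frc \<equiv> forces s num A app"

lemma eq_mono:
  assumes "typed_env e" "c \<in> nodes" "d \<in> nodes" "ext d c"
    "ty t = Some k" "tmax t \<le> s" "ty r = Some k" "tmax r \<le> s"
    "evalt num A app e c t \<noteq> None \<and> evalt num A app e c t = evalt num A app e c r"
  shows "evalt num A app e d t \<noteq> None \<and> evalt num A app e d t = evalt num A app e d r"
proof -
  obtain u where "evalt num A app e c t = Some u" "evalt num A app e c r = Some u"
    using assms(9) by fastforce
  then show ?thesis
    using evalt_mono[OF assms(1-6)] evalt_mono[OF assms(1-4,7,8)] by simp
qed

lemma forces_mono:
  "isL p \<Longrightarrow> wf p \<Longrightarrow> fmax p \<le> s \<Longrightarrow> typed_env e \<Longrightarrow> a \<in> nodes \<Longrightarrow> b \<in> nodes \<Longrightarrow> ext b a \<Longrightarrow>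
    frc p a e \<Longrightarrow> frc p b e"
proof (induction p arbitrary: a b e)
  case (Eq0 t r)
  have "ty t = Some 0" "tmax t \<le> s" "ty r = Some 0" "tmax r \<le> s" using Eq0 by auto
  note m = eq_mono[OF \<open>typed_env e\<close> _ _ _ this]
  show ?case unfolding forces.simps
    by (rule barred_mono[OF m]) (use Eq0 in auto)
next
  case (EqH n t r)
  have "ty t = Some n" "tmax t \<le> s" "ty r = Some n" "tmax r \<le> s" using EqH by auto
  note m = eq_mono[OF \<open>typed_env e\<close> _ _ _ this]
  show ?case unfolding forces.simps
    by (rule barred_mono[OF m]) (use EqH in auto)
next
  case (Dj p q)
  show ?case unfolding forces.simps
    by (rule barred_mono[where a=a]) (use Dj in auto)
next
  case (Exi x p)
  show ?case unfolding forces.simps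
  proof (rule barred_mono[where a=a])
    fix c d assume cd: "c \<in> nodes" "d \<in> nodes" "ext d c" "\<exists>u\<in>vdom A app x. frc p c (e(x := u))"
    then obtain u where u: "u \<in> vdom A app x" "frc p c (e(x := u))" by blast
    then have "frc p d (e(x := u))"
      using Exi cd typed_env_upd[of e u x] by auto
    then show "\<exists>u\<in>vdom A app x. frc p d (e(x := u))" using u by blast
  qed (use Exi in auto)
next
  case (Al x p)
  then show ?case using typed_env_upd[of e _ x] by auto
next
  case (Im p q)
  show ?case unfolding forces.simps
  proof (intro ballI impI)
    fix c assume "c \<in> nodes" "ext c b" "frc p c e"
    then show "frc q c e" using Im.prems(8) ext_trans[OF _ Im.prems(7)] by simp
  qed
qed auto

text \<open>The main case is implication. Let \<open>c\<close> be later than \<open>a\<close> and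
  force the antecedent. A path through \<open>c\<close> meets the bar either beyond
  \<open>c\<close>, where monotonicity keeps the antecedent, or before \<open>c\<close>, where the
  implication applies at \<open>c\<close> itself.\<close>

lemma forces_barred:
  "isL p \<Longrightarrow> wf p \<Longrightarrow> fmax p \<le> s \<Longrightarrow> typed_env e \<Longrightarrow> a \<in> nodes \<Longrightarrow>
    barred s A a (\<lambda>b. frc p b e) \<Longrightarrow> frc p a e"
proof (induction p arbitrary: a e)
  case Bot
  then show ?case using node_path by (auto simp: barred_def)
next
  case (Im p q)
  show ?case unfolding forces.simps
  proof (intro ballI impI)
    fix c assume c: "c \<in> nodes" "ext c a" "frc p c e"
    have "barred s A c (\<lambda>b. frc q b e)"
      unfolding barred_def
    proof (intro ballI impI)
      fix P assume P: "P \<in> paths nodes" "c \<in> P"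
      then have "a \<in> P" using paths_downward c Im by blast
      then obtain b where b: "b \<in> P" "frc (Im p q) b e"
        using Im.prems P unfolding barred_def by blast
      have bn: "b \<in> nodes" using b P paths_dset by blast
      from paths_linear[OF P(1) b(1) P(2)] show "\<exists>b\<in>P. ext b c \<and> frc q b e"
      proof
        assume "ext b c"
        then have "frc p b e" using forces_mono[of p e c b] c bn Im.prems(1-4) by simp
        then have "frc q b e" using b(2) bn by simp
        then show ?thesis using b \<open>ext b c\<close> by blast
      next
        assume "ext c b"
        then have "frc q c e" using b(2) c by simp
        then show ?thesis using P ext_refl by blast
      qed
    qed
    then show "frc q c e" using Im.IH(2)[of e c] Im.prems(1-4) c(1) by simp
  qed
next
  case (Cj p q)
  have "barred s A a (\<lambda>b. frc p b e)" "barred s A a (\<lambda>b. frc q b e)"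
    using Cj.prems(6) by (auto elim: barred_conv)
  then show ?case using Cj by auto
next
  case (Al x p)
  have "barred s A a (\<lambda>b. frc p b (e(x := d)))" if "d \<in> vdom A app x" for d
    using Al.prems(6) that by (auto elim: barred_conv)
  then show ?case using Al typed_env_upd[of e _ x] by auto
qed (auto dest: barred_barred)

end

section \<open>Automorphisms of the Beth model\<close>

text \<open>\<open>\<pi> i j\<close> acts on the label at position \<open>j\<close> of component
  \<open>i\<close>. Requiring involutions makes all induced maps self-inverse, so no separate
  inverse has to be carried along.\<close>

locale beth_relabelling = beth s num A app for s and num :: "nat \<Rightarrow> 'u" and A app +
  fixes \<pi> :: "nat \<Rightarrow> nat \<Rightarrow> 'u \<Rightarrow> 'u"
  assumes \<pi>_invol [simp]: "\<pi> i j (\<pi> i j u) = u"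
    and \<pi>_mem: "u \<in> A i \<Longrightarrow> \<pi> i j u \<in> A i"
begin

section \<open>Relabelling of nodes and the induced action on functionals\<close>

definition relabel :: "'u node \<Rightarrow> 'u node" where
  "relabel x = map (\<lambda>i. map (\<lambda>j. \<pi> i j (x ! i ! j)) [0..<length (x ! i)]) [0..<length x]"

lemma length_relabel [simp]: "length (relabel x) = length x"
  by (simp add: relabel_def)

lemma relabel_nth [simp]:
  "i < length x \<Longrightarrow> length (relabel x ! i) = length (x ! i)"
  "i < length x \<Longrightarrow> j < length (x ! i) \<Longrightarrow> relabel x ! i ! j = \<pi> i j (x ! i ! j)"
  by (simp_all add: relabel_def)

lemma relabel_relabel [simp]: "relabel (relabel x) = x"
  by (intro nth_equalityI) auto

lemma relabel_take: "relabel (take n x) = take n (relabel x)"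
  by (intro nth_equalityI) auto

lemma relabel_root [simp]: "relabel (replicate k []) = replicate k []"
  by (intro nth_equalityI) auto

lemma lh_relabel: "x \<in> dset A k \<Longrightarrow> lh (relabel x) = lh x"
  by (auto simp: dset_def lh_def)

lemma relabel_dset_imp: "x \<in> dset A k \<Longrightarrow> relabel x \<in> dset A k"
  using lh_relabel[of x k] \<pi>_mem unfolding dset_iff
  by (fastforce simp: in_set_conv_nth subset_iff)

lemma relabel_dset [simp]: "relabel x \<in> dset A k \<longleftrightarrow> x \<in> dset A k"
  using relabel_dset_imp relabel_relabel by metis

lemma ext_relabel_imp: "ext y x \<Longrightarrow> ext (relabel y) (relabel x)"
  by (auto simp: ext_def prefix_iff_nth)

lemma ext_relabel: "ext (relabel y) (relabel x) \<longleftrightarrow> ext y x"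
  using ext_relabel_imp relabel_relabel by metis

lemma paths_relabel:
  assumes P: "P \<in> paths (dset A k)"
  shows "relabel ` P \<in> paths (dset A k)"
  unfolding paths_def mem_Collect_eq
proof (intro conjI ballI impI)
  show "relabel ` P \<subseteq> dset A k" using paths_dset[OF P] by auto
next
  fix x y assume "x \<in> relabel ` P" "y \<in> relabel ` P"
  then show "ext x y \<or> ext y x" using paths_linear[OF P] ext_relabel by auto
next
  fix z assume z: "z \<in> dset A k" "\<forall>x\<in>relabel ` P. ext z x \<or> ext x z"
  have "relabel z \<in> P"
  proof (rule paths_maximal[OF P])
    fix x assume "x \<in> P"
    then have "ext z (relabel x) \<or> ext (relabel x) z" using z by blast
    then show "ext (relabel z) x \<or> ext x (relabel z)"
      using ext_relabel relabel_relabel by metis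
  qed (use z in simp)
  then show "z \<in> relabel ` P" by (metis imageI relabel_relabel)
qed

text \<open>Conjugation by the relabelling, which is its own inverse. Numbers as values stay fixed
  even when \<open>\<pi> 0 j\<close> moves number labels inside nodes, so arithmetic is
  preserved.\<close>

primrec act :: "nat \<Rightarrow> 'u \<Rightarrow> 'u" where
  "act 0 = (\<lambda>u. u)"
| "act (Suc k) = (\<lambda>f. THE g. g \<in> A (Suc k) \<and>
     (\<forall>x n. app g x n = map_option (act k) (app f (relabel x) n)))"

lemma act_mem: "k \<le> s \<Longrightarrow> f \<in> A k \<Longrightarrow> act k f \<in> A k"
  and app_act: "Suc k \<le> s \<Longrightarrow> f \<in> A (Suc k) \<Longrightarrow>
    app (act (Suc k) f) x n = map_option (act k) (app f (relabel x) n)"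
proof -
  have valid: "validfn A (Suc k) (\<lambda>x n. map_option (act k) (app f (relabel x) n))"
    if "Suc k \<le> s" "f \<in> A (Suc k)" "\<And>f. f \<in> A k \<Longrightarrow> act k f \<in> A k" for k f
    using validfn_map[OF app_valid[OF that(1,2)], of "act k" relabel] that(3)
      paths_relabel ext_relabel by simp
  have mem: "k \<le> s \<Longrightarrow> f \<in> A k \<Longrightarrow> act k f \<in> A k" for k f
  proof (induction k arbitrary: f)
    case (Suc k)
    then show ?case using the_functional(1)[OF _ valid] by simp
  qed simp
  show "k \<le> s \<Longrightarrow> f \<in> A k \<Longrightarrow> act k f \<in> A k" by (rule mem)
  show "Suc k \<le> s \<Longrightarrow> f \<in> A (Suc k) \<Longrightarrow>
    app (act (Suc k) f) x n = map_option (act k) (app f (relabel x) n)"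
    using the_functional(2)[OF _ valid] mem by simp
qed

lemma app_mem: "Suc k \<le> s \<Longrightarrow> f \<in> A (Suc k) \<Longrightarrow> app f x n = Some u \<Longrightarrow> u \<in> A k"
  by (rule validfn_mem[OF app_valid])

lemma act_act: "k \<le> s \<Longrightarrow> f \<in> A k \<Longrightarrow> act k (act k f) = f"
proof (induction k arbitrary: f)
  case (Suc k)
  show ?case
  proof (rule app_eqI)
    fix x n
    show "app (act (Suc k) (act (Suc k) f)) x n = app f x n"
      using Suc app_mem[of k f x n] act_mem[of "Suc k" f]
      by (cases "app f x n") (auto simp: app_act simp del: act.simps)
  qed (use Suc act_mem in \<open>auto simp del: act.simps\<close>)
qed simp

lemma act_const: "k \<le> s \<Longrightarrow> act k (const i k) = const i k"
proof (induction k)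
  case (Suc k)
  show ?case
    by (rule app_eqI[of k])
      (use Suc const_mem[of "Suc k"] act_mem[of "Suc k"] in
        \<open>auto simp: app_act app_const simp del: act.simps const.simps\<close>)
qed simp

lemma act_Shat: "k \<le> s \<Longrightarrow> f \<in> A k \<Longrightarrow> act k (Shat num A app k f) = Shat num A app k (act k f)"
proof (induction k arbitrary: f)
  case (Suc k)
  show ?case
  proof (rule app_eqI)
    fix x n
    show "app (act (Suc k) (Shat num A app (Suc k) f)) x n
      = app (Shat num A app (Suc k) (act (Suc k) f)) x n"
      using Suc app_mem[of k f "relabel x" n] act_mem[of "Suc k" f] Shat_mem[of "Suc k" f]
      by (cases "app f (relabel x) n") (auto simp: app_act app_Shat simp del: act.simps Shat.simps)
  qed (use Suc act_mem Shat_mem in \<open>auto simp del: act.simps Shat.simps\<close>)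
qed simp

text \<open>A functional of type at most \<open>m\<close> reads only the first \<open>m\<close>
  components of a node. These are not relabelled, and its values are fixed by induction.\<close>

lemma act_fixed:
  assumes "\<And>i j u. i < m \<Longrightarrow> \<pi> i j u = u"
  shows "k \<le> m \<Longrightarrow> k \<le> s \<Longrightarrow> f \<in> A k \<Longrightarrow> act k f = f"
proof (induction k arbitrary: f)
  case (Suc k)
  have id: "relabel x = x" if "x \<in> dset A k" for x
    using that assms Suc.prems by (intro nth_equalityI) (auto simp: dset_iff)
  have none: "app f x n = None" if "x \<notin> dset A k" for x n
    by (rule validfn_undef[OF app_valid[OF Suc.prems(2,3)] that])
  show ?case
  proof (rule app_eqI)
    fix x n
    show "app (act (Suc k) f) x n = app f x n"
      using Suc app_mem[of k f x n] none[of x n] none[of "relabel x" n] id[of x]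
      by (cases "x \<in> dset A k"; cases "app f x n") (auto simp: app_act simp del: act.simps)
  qed (use Suc act_mem in \<open>auto simp del: act.simps\<close>)
qed simp

lemma act_bij: "k \<le> s \<Longrightarrow> bij_betw (act k) (A k) (A k)"
  by (rule bij_betw_byWitness[where f'="act k"]) (auto simp: act_act act_mem)

lemma \<pi>_bij: "bij_betw (\<pi> i j) (A i) (A i)"
  by (rule bij_betw_byWitness[where f'="\<pi> i j"]) (auto simp: \<pi>_mem)

text \<open>The root carries no labels and is fixed by relabelling, so totality at the root is
  preserved.\<close>

lemma act_bset:
  assumes "1 \<le> k" "k \<le> s" "f \<in> bset A app k"
  shows "act k f \<in> bset A app k"
  using assms app_act[of "k - 1" f] act_mem[of k f]
  by (cases k) (auto simp: bset_def simp del: act.simps replicate_Suc)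

text \<open>A lawless functional reads the \<open>n\<close>-th label of the last component through a
  bijection. Both the relabelling of that label and the action on the value are absorbed into this
  bijection, which gives \<open>\<xi>'\<close>.\<close>

lemma act_lset:
  assumes k: "1 \<le> k" "k \<le> s" and f: "f \<in> lset A app k"
  shows "act k f \<in> lset A app k"
proof -
  from f obtain \<xi> where \<xi>: "\<And>n. bij_betw (\<xi> n) (A (k - 1)) (A (k - 1))"
    "\<And>x n. app f x n = (if x \<in> dset A (k - 1) \<and> n < lh x then Some (\<xi> n (x ! (k - 1) ! n)) else None)"
    and fA: "f \<in> A k"
    by (auto simp: lset_def)
  obtain k' where k': "k = Suc k'" using k by (cases k) auto
  define \<xi>' where "\<xi>' n = act k' \<circ> (\<xi> n \<circ> \<pi> k' n)" for n
  have "bij_betw (\<xi>' n) (A k') (A k')" for n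
    using \<xi>(1) act_bij[of k'] \<pi>_bij k k' unfolding \<xi>'_def by (auto intro!: bij_betw_trans)
  moreover have "app (act k f) x n =
      (if x \<in> dset A k' \<and> n < lh x then Some (\<xi>' n (x ! k' ! n)) else None)" for x n
  proof (cases "x \<in> dset A k' \<and> n < lh x")
    case True
    then have "relabel x ! k' ! n = \<pi> k' n (x ! k' ! n)" by (auto simp: dset_iff)
    then show ?thesis
      using k k' fA \<xi>(2) True lh_relabel[of x k'] by (simp add: app_act \<xi>'_def del: act.simps)
  next
    case False
    then show ?thesis
      using k k' fA \<xi>(2) lh_relabel[of x k'] by (auto simp: app_act simp del: act.simps)
  qed
  ultimately show ?thesis
    using act_mem[OF k(2) fA] k' unfolding lset_def by auto
qed

lemma act_vdom: "vwf x \<Longrightarrow> vty x \<le> s \<Longrightarrow> d \<in> vdom A app x \<Longrightarrow> act (vty x) d \<in> vdom A app x"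
  by (cases "(A, app, x)" rule: vdom.cases) (auto simp: act_bset act_lset act_mem)

section \<open>Invariance of evaluation and forcing\<close>

lemma evalt_act:
  assumes "typed_env e" "a \<in> nodes"
  shows "ty t = Some k \<Longrightarrow> tmax t \<le> s \<Longrightarrow> (\<And>v. v \<in> fvt t \<Longrightarrow> e' v = act (vty v) (e v)) \<Longrightarrow>
    evalt num A app e' (relabel a) t = map_option (act k) (evalt num A app e a t)"
proof (induction t arbitrary: k)
  case (Ap n f t)
  obtain n' where n': "n = Suc n'" using Ap by (cases n) auto
  have f: "evalt num A app e' (relabel a) f = map_option (act n) (evalt num A app e a f)"
    and t: "evalt num A app e' (relabel a) t = evalt num A app e a t"
    using Ap.IH Ap.prems by (auto split: if_splits simp: option.map_ident)
  have k: "k = n'" "n \<le> s" using Ap.prems n' by (auto split: if_splits)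
  show ?case
  proof (cases "evalt num A app e a f")
    case (Some w)
    then have "w \<in> A n" using evalt_mem[OF assms, of f n w] Ap.prems by (auto split: if_splits)
    then have "app (act n w) (take n (relabel a)) i = map_option (act n') (app w (take n a) i)" for i
      using k n' by (simp add: app_act relabel_take del: act.simps)
    then show ?thesis using f t k Some by (auto split: option.splits)
  qed (use f in simp)
next
  case (Nc n t)
  then have "evalt num A app e' (relabel a) t = map_option (act n) (evalt num A app e a t)"
    by (auto split: if_splits)
  then show ?case
    using Nc.prems evalt_mem[OF assms, of t n] act_Shat[of n]
    by (cases "evalt num A app e a t") (auto split: if_splits)
qed (auto simp: Khat_const act_const option.map_ident split: if_splits option.splits)

text \<open>A path through \<open>relabel a\<close> is mapped by the relabelling to a path through
  \<open>a\<close>, and the bar met there is carried back.\<close>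

lemma barred_relabel:
  assumes "barred s A a Q" "\<And>b. b \<in> nodes \<Longrightarrow> Q b \<Longrightarrow> R (relabel b)"
  shows "barred s A (relabel a) R"
  unfolding barred_def
proof (intro ballI impI)
  fix P assume P: "P \<in> paths nodes" "relabel a \<in> P"
  then have "relabel ` P \<in> paths nodes" "a \<in> relabel ` P"
    using paths_relabel by (auto simp: image_iff intro: bexI[of _ "relabel a"])
  then obtain b where "b \<in> P" "ext (relabel b) a" "Q (relabel b)"
    using assms(1) unfolding barred_def by blast
  then have "b \<in> P \<and> ext b (relabel a) \<and> R b"
    using assms(2)[of "relabel b"] paths_dset[OF P(1)] ext_relabel[of "relabel b" a] by auto
  then show "\<exists>b\<in>P. ext b (relabel a) \<and> R b" by blast
qed

lemma eq_relabel:
  assumes "typed_env e" "a \<in> nodes" "ty t = Some k" "tmax t \<le> s" "ty r = Some k" "tmax r \<le> s"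
    "\<And>v. v \<in> fvt t \<union> fvt r \<Longrightarrow> e' v = act (vty v) (e v)"
    "evalt num A app e a t \<noteq> None \<and> evalt num A app e a t = evalt num A app e a r"
  shows "evalt num A app e' (relabel a) t \<noteq> None \<and>
    evalt num A app e' (relabel a) t = evalt num A app e' (relabel a) r"
proof -
  obtain u where "evalt num A app e a t = Some u" "evalt num A app e a r = Some u"
    using assms(8) by fastforce
  then show ?thesis
    using evalt_act[OF assms(1-4), of e'] evalt_act[OF assms(1,2,5,6), of e'] assms(7) by simp
qed

lemma forces_relabel:
  "isL p \<Longrightarrow> wf p \<Longrightarrow> fmax p \<le> s \<Longrightarrow> typed_env e \<Longrightarrow> typed_env e' \<Longrightarrow> a \<in> nodes \<Longrightarrow>
    (\<And>v. v \<in> fvf p \<Longrightarrow> e' v = act (vty v) (e v)) \<Longrightarrow> frc p a e \<Longrightarrow> frc p (relabel a) e'"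
proof (induction p arbitrary: a e e')
  case (Eq0 t r)
  have "ty t = Some 0" "tmax t \<le> s" "ty r = Some 0" "tmax r \<le> s" using Eq0 by auto
  note eq = eq_relabel[OF \<open>typed_env e\<close> _ this]
  show ?case unfolding forces.simps
    by (rule barred_relabel[OF Eq0.prems(8)[unfolded forces.simps]], rule eq)
      (assumption, simp add: Eq0.prems(7), assumption)
next
  case (EqH n t r)
  have "ty t = Some n" "tmax t \<le> s" "ty r = Some n" "tmax r \<le> s" using EqH by auto
  note eq = eq_relabel[OF \<open>typed_env e\<close> _ this]
  show ?case unfolding forces.simps
    by (rule barred_relabel[OF EqH.prems(8)[unfolded forces.simps]], rule eq)
      (assumption, simp add: EqH.prems(7), assumption)
next
  case (Dj p q)
  show ?case unfolding forces.simps
    by (rule barred_relabel[OF Dj.prems(8)[unfolded forces.simps]]) (use Dj in auto)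
next
  case (Cj p q)
  then show ?case by auto
next
  case (Im p q)
  \<comment> \<open>The antecedent must be transported backwards. The action is an involution, so
    the induction hypothesis applies with \<open>e\<close> and \<open>e'\<close> exchanged.\<close>
  have inv: "e v = act (vty v) (e' v)" if "v \<in> fvf p" for v
    using Im.prems that fvf_bound[of p v] act_act[of "vty v" "e v"] by (auto simp: typed_env_def)
  show ?case unfolding forces.simps
  proof (intro ballI impI)
    fix b assume b: "b \<in> nodes" "ext b (relabel a)" "frc p b e'"
    then have "frc p (relabel b) e" using Im.IH(1)[of e' e b] Im.prems(1-5) inv by simp
    moreover have "ext (relabel b) a" using b ext_relabel[of b "relabel a"] by simp
    ultimately have "frc q (relabel b) e" using Im.prems b by simp
    then have "frc q (relabel (relabel b)) e'"
      using Im.IH(2)[of e e' "relabel b"] Im.prems(1-5,7) b(1) by simp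
    then show "frc q b e'" by simp
  qed
next
  case (Al x p)
  show ?case unfolding forces.simps
  proof
    fix d assume d: "d \<in> vdom A app x"
    \<comment> \<open>The preimage of \<open>d\<close> under the action, which is again
      \<open>act\<close> of \<open>d\<close>; it lies in the same domain because each kind of
      variable is preserved.\<close>
    define d' where "d' = act (vty x) d"
    have x: "vwf x" "vty x \<le> s" using Al by auto
    have d': "d' \<in> vdom A app x" "act (vty x) d' = d"
      using act_vdom[OF x d] act_act[OF x(2)] vdom_subset d unfolding d'_def by auto
    show "frc p (relabel a) (e'(x := d))"
    proof (rule Al.IH[of "e(x := d')"])
      show "typed_env (e(x := d'))" "typed_env (e'(x := d))"
        using typed_env_upd Al.prems(4,5) d d' by blast+
      show "frc p a (e(x := d'))" using Al.prems(8) d' by simp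
      show "(e'(x := d)) v = act (vty v) ((e(x := d')) v)" if "v \<in> fvf p" for v
        using that d' Al.prems(7)[of v] by simp
    qed (use Al.prems in auto)
  qed
next
  case (Exi x p)
  have x: "vwf x" "vty x \<le> s" using Exi by auto
  show ?case unfolding forces.simps
  proof (rule barred_relabel[OF Exi.prems(8)[unfolded forces.simps]])
    fix b assume b: "b \<in> nodes" "\<exists>d\<in>vdom A app x. frc p b (e(x := d))"
    then obtain d where d: "d \<in> vdom A app x" "frc p b (e(x := d))" by blast
    have "frc p (relabel b) (e'(x := act (vty x) d))"
    proof (rule Exi.IH[of "e(x := d)"])
      show "typed_env (e(x := d))" "typed_env (e'(x := act (vty x) d))"
        using typed_env_upd Exi.prems(4,5) d act_vdom[OF x] by blast+
      show "(e'(x := act (vty x) d)) v = act (vty v) ((e(x := d)) v)" if "v \<in> fvf p" for v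
        using that Exi.prems(7)[of v] by simp
      show "frc p b (e(x := d))" by (rule d(2))
    qed (use Exi.prems(1-3) b(1) in auto)
    then show "\<exists>d\<in>vdom A app x. frc p (relabel b) (e'(x := d))"
      using act_vdom[OF x d(1)] by blast
  qed
qed auto

end

section \<open>Kripke's schema is forced\<close>

context beth
begin

text \<open>Two environments are allowed so that the case \<open>b = c\<close> gives the coincidence
  property: forcing depends only on the values of free variables.\<close>

lemma forces_homogeneous:
  assumes p: "isL p" "wf p" "fmax p \<le> s" and e: "typed_env e" "typed_env e'"
    and bc: "b \<in> nodes" "c \<in> nodes" "take m b = take m c" and m: "1 \<le> m" "sortf p \<le> m"
    and ee: "\<And>v. v \<in> fvf p \<Longrightarrow> e' v = e v" and f: "frc p b e"
  shows "frc p c e'"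
proof -
  \<comment> \<open>At each position the labels of \<open>b\<close> and \<open>c\<close> are
    transposed. Where they agree, in particular in the first \<open>m\<close> components, nothing
    moves.\<close>
  define \<pi> where "\<pi> i j u = (if i < s \<and> j < lh b then
      if u = b ! i ! j then c ! i ! j else if u = c ! i ! j then b ! i ! j else u else u)"
    for i j and u :: 'u
  \<comment> \<open>As \<open>m\<close> is positive, the common part contains component 0, which
    determines the length of a node.\<close>
  have lh: "lh b = lh c" using bc(3) m lh_take by metis
  have len: "length b = s" "length c = s" "\<And>i. i < s \<Longrightarrow> length (b ! i) = lh b"
    "\<And>i. i < s \<Longrightarrow> length (c ! i) = lh b" "\<And>i. i < s \<Longrightarrow> set (b ! i) \<subseteq> A i"
    "\<And>i. i < s \<Longrightarrow> set (c ! i) \<subseteq> A i"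
    using bc(1,2) s_pos lh by (auto simp: dset_iff)
  have nodes_mem: "b ! i ! j \<in> A i" "c ! i ! j \<in> A i" if "i < s" "j < lh b" for i j
    using that len nth_mem by (metis subsetD)+
  interpret beth_relabelling s num A app \<pi>
  proof
    show "\<pi> i j (\<pi> i j u) = u" for i j u by (simp add: \<pi>_def)
    show "\<pi> i j u \<in> A i" if "u \<in> A i" for u i j
      using that nodes_mem by (simp add: \<pi>_def)
  qed
  have c: "relabel b = c"
    using len by (intro nth_equalityI) (auto simp: \<pi>_def)
  have fixed: "\<pi> i j u = u" if "i < m" for i j u
    using that bc(3) nth_take[of i m b] nth_take[of i m c] by (auto simp: \<pi>_def)
  have "e' v = act (vty v) (e v)" if v: "v \<in> fvf p" for v
  proof -
    have "vty v \<le> m" using m(2) v sortf_le_iff by blast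
    moreover have "vwf v" "vty v \<le> s" using fvf_bound[OF p(2) v] p(3) by auto
    ultimately show ?thesis
      using act_fixed[of m "vty v" "e v"] fixed e(1) ee[OF v] by (auto simp: typed_env_def)
  qed
  then show ?thesis using forces_relabel[OF p e bc(1) _ f] c by simp
qed

lemma evalt_iterap_const:
  assumes "d \<in> nodes"
  shows "evalt num A app e d t = Some (const i k) \<Longrightarrow> j \<le> k \<Longrightarrow> k \<le> s \<Longrightarrow>
    evalt num A app e d (iterap j k t) = Some (const i (k - j))"
proof (induction j arbitrary: k t)
  case (Suc j)
  obtain k' where k': "k = Suc k'" using Suc.prems by (cases k) auto
  have "take (Suc k') d \<in> dset A k'" using take_node[OF assms, of "Suc k'"] Suc.prems k' by simp
  then have "evalt num A app e d (Ap k t Zr) = Some (const i k')"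
    using Suc.prems k' app_const[of k'] by (simp del: const.simps)
  then show ?case using Suc k' by simp
qed simp

lemma forces_ks:
  assumes "ks a" "inLang (Some s) a" "admissible s A app e"
  shows "frc a (replicate s []) e"
  using assms(1)
proof (cases rule: ks.cases)
  case (1 p G m k x i)
  have m: "1 \<le> m" "sortf p \<le> m" "m \<le> s" and p: "isL p" "wf p" "fmax p \<le> s"
    using 1 assms(2) by (auto simp: inLang_def Iff_def)
  \<comment> \<open>By homogeneity, if some node with first \<open>m\<close> components
    \<open>z\<close> forces \<open>p\<close>, then all such nodes do. This turns forcing of
    \<open>p\<close> into a property of nodes that a functional of type \<open>m\<close> can
    read.\<close>
  define \<Phi> where "\<Phi> z \<longleftrightarrow> (\<exists>c\<in>nodes. take m c = z \<and> frc p c e)" for z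
  \<comment> \<open>The value at \<open>n\<close> is given once the node has length at least
    \<open>n\<close> and then depends only on its truncation to \<open>n\<close>. This makes
    \<open>h\<close> monotone; it is complete because every path contains a node of length
    \<open>n\<close>.\<close>
  define h where "h y n = (if y \<in> dset A (m - 1) \<and> n \<le> lh y
      then Some (const (if \<Phi> (trunc n y) then 1 else 0) (m - 1)) else None)" for y n
  define \<gamma> where "\<gamma> = (THE g. g \<in> A m \<and> (\<forall>x n. app g x n = h x n))"
  have e: "typed_env e"
    using assms(3) vdom_subset unfolding admissible_def typed_env_def by blast
  obtain m' where m': "m = Suc m'" using m by (cases m) auto
  have valid: "validfn A (Suc m') h"
    unfolding validfn_Suc
  proof (intro conjI allI impI ballI)
    fix P n assume P: "P \<in> paths (dset A m')"
    have "i \<le> m' \<Longrightarrow> A i \<noteq> {}" for i using A_nonempty[of i] m m' by simp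
    then obtain y where "y \<in> P" "lh y = n" using paths_length[OF P] by blast
    then show "\<exists>y\<in>P. h y n \<noteq> None" using paths_dset[OF P] m' by (auto simp: h_def)
  next
    fix y n v assume "h y n = Some v"
    then show "v \<in> A m'" using const_mem[of m'] m m' by (auto simp: h_def split: if_splits)
  next
    fix y z n v assume "y \<in> dset A m'" "z \<in> dset A m'" "ext z y" "h y n = Some v"
    then show "h z n = Some v"
      using lh_ext[of y A m' z] trunc_ext[of y A m' z n] m'
      by (auto simp: h_def split: if_splits)
  qed (use m' in \<open>auto simp: h_def\<close>)
  have \<gamma>: "\<gamma> \<in> A m" "app \<gamma> y n = h y n" for y n
    using the_functional[OF _ valid] m m' unfolding \<gamma>_def by auto
  define e' where "e' = e(G := \<gamma>)"
  have G: "vdom A app G = A m" "x \<noteq> G" and x: "vdom A app x = range num"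
    using 1 A_0 by auto
  have e': "typed_env e'" "\<And>v. v \<in> fvf p \<Longrightarrow> e' v = e v"
    using typed_env_upd[OF e] \<gamma>(1) G 1 by (auto simp: e'_def)
  define t where "t = appz G x m (m - 1)"
  have val: "evalt num A app (e'(x := num n)) d t
      = Some (num (if \<Phi> (trunc n (take m d)) then 1 else 0))" if "d \<in> nodes" "n \<le> lh d" for d n
  proof -
    have "evalt num A app (e'(x := num n)) d (Ap m (V G) (V x))
        = Some (const (if \<Phi> (trunc n (take m d)) then 1 else 0) (m - 1))"
      using that \<gamma>(2) G take_node[of d m] m lh_take[of m d] by (simp add: e'_def h_def)
    from evalt_iterap_const[OF that(1) this, of "m - 1"] show ?thesis
      using m by (simp add: t_def appz_def)
  qed
  have num: "num 1 \<noteq> num 0" using univ by (simp add: beth_univ_def inj_eq)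
  let ?N = "Neg (Eq0 t Zr)"
  have stable: "\<Phi> (trunc n (take m d)) \<longleftrightarrow> frc p (trunc n d) e" if "d \<in> nodes" for n d
    unfolding \<Phi>_def
  proof
    assume "\<exists>c\<in>nodes. take m c = trunc n (take m d) \<and> frc p c e"
    then obtain c where "c \<in> nodes" "take m c = take m (trunc n d)" "frc p c e"
      by (auto simp: take_trunc)
    then show "frc p (trunc n d) e"
      using forces_homogeneous[OF p e e _ trunc_dset[OF that]] m by blast
  next
    assume "frc p (trunc n d) e"
    then show "\<exists>c\<in>nodes. take m c = trunc n (take m d) \<and> frc p c e"
      using trunc_dset[OF that] take_trunc by metis
  qed
  have fwd: "frc (Exi x ?N) c e'" if c: "c \<in> nodes" and pc: "frc p c e" for c
    unfolding forces.simps
  \<comment> \<open>The witness for \<open>x\<close> is the length of \<open>c\<close>: every later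
    node truncates to \<open>c\<close> at that length, and \<open>c\<close> forces \<open>p\<close>,
    so the recorded value is 1.\<close>
  proof (rule barredI_self, rule bexI)
    show "frc ?N c (e'(x := num (lh c)))"
      unfolding Neg_def forces.simps(1,7)
    proof (intro ballI impI)
      fix d assume d: "d \<in> nodes" "ext d c" and zero: "frc (Eq0 t Zr) d (e'(x := num (lh c)))"
      obtain P where P: "P \<in> paths nodes" "d \<in> P" using node_path[OF d(1)] by blast
      with zero obtain b where b: "b \<in> P" "ext b d"
        "evalt num A app (e'(x := num (lh c))) b t = Some (num 0)"
        unfolding forces.simps barred_def evalt.simps by blast
      have bn: "b \<in> nodes" using paths_dset P b by blast
      have bc: "ext b c" using ext_trans b d by blast
      have "trunc (lh c) b = c" using ext_iff_trunc[OF c bn] bc by metis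
      then have "\<Phi> (trunc (lh c) (take m b))" using stable[OF bn] pc by simp
      then show False using val[OF bn lh_ext[OF c bn bc]] b(3) num by simp
    qed
  qed (use x in simp)
  have bwd: "frc p c e" if c: "c \<in> nodes" and ex: "frc (Exi x ?N) c e'" for c
  proof (rule forces_barred[OF p e c])
    show "barred s A c (\<lambda>b. frc p b e)"
      unfolding barred_def
    proof (intro ballI impI)
      fix P assume P: "P \<in> paths nodes" "c \<in> P"
      then have "\<exists>b\<in>P. ext b c \<and> (\<exists>n. frc ?N b (e'(x := num n)))"
        using ex unfolding forces.simps(9) barred_def x by simp
      then obtain b n where b: "b \<in> P" "ext b c" "frc ?N b (e'(x := num n))" by blast
      \<comment> \<open>Go further along the path until the recorded value at \<open>n\<close> is
        defined. Were it 0, then \<open>d\<close> would force the equation that \<open>b\<close>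
        refutes; so the truncation of \<open>d\<close> forces \<open>p\<close>, and hence so does
        \<open>d\<close>.\<close>
      obtain d where d: "d \<in> P" "ext d b" "n \<le> lh d"
        using path_beyond[OF P(1) b(1)] by blast
      have dn: "d \<in> nodes" using paths_dset P d by blast
      have "frc p (trunc n d) e"
      proof (rule ccontr)
        assume no: "\<not> frc p (trunc n d) e"
        have "frc (Eq0 t Zr) d (e'(x := num n))"
          unfolding forces.simps
          by (rule barredI_self) (use val[OF dn d(3)] stable[OF dn] no in simp)
        then show False using b(3) d(2) dn unfolding Neg_def by simp
      qed
      then have "frc p d e"
        using forces_mono[OF p e trunc_dset[OF dn] dn ext_trunc] by blast
      then show "\<exists>b\<in>P. ext b c \<and> frc p b e" using d b ext_trans by blast
    qed
  qed
  \<comment> \<open>\<open>G\<close> is not free in \<open>p\<close>, so assigning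
    \<open>\<gamma>\<close> to it does not affect the forcing of \<open>p\<close>.\<close>
  have same: "frc p c e' \<longleftrightarrow> frc p c e" if "c \<in> nodes" for c
    using forces_homogeneous[OF p e e'(1) that that _ m(1,2)]
      forces_homogeneous[OF p e'(1) e that that _ m(1,2)] e'(2) by auto
  have "frc (Iff p (Exi x ?N)) c e'" for c
    unfolding Iff_def forces.simps(5,7) using fwd bwd same by blast
  then have "frc (Exi G (Iff p (Exi x ?N))) c e" for c
    unfolding forces.simps(9) e'_def using G \<gamma>(1) by (intro barredI_self) blast
  then show ?thesis using 1 by (simp add: t_def)
qed

end

theorem theorem10p1:
  shows
   "(\<forall>s\<ge>1. \<forall>a. ks a \<and> inLang (Some s) a \<longrightarrow> deriv (Some s) Cset a)
    \<and> (\<forall>a. ks a \<and> inLang None a \<longrightarrow> deriv None Cset a)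
    \<and> (\<forall>s\<ge>1. \<forall>(num :: nat \<Rightarrow> 'u) A app. beth_univ s num A app \<longrightarrow>
         (\<forall>a. ks a \<and> inLang (Some s) a \<longrightarrow>
            (\<forall>e. admissible s A app e \<longrightarrow>
               forces s num A app a (replicate s []) e)))"
  using deriv_ks beth.forces_ks[OF beth.intro] by blast

end
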